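(* A linear homogeneous ordinary differential equation of order $n$ is iterative if and only if it can be reduced to the canonical form $w^{(n)}(z)=0$ by an invertible point transformation.
   Context: All functions are smooth and all considerations are local (on sufficiently small intervals). Equations are linear homogeneous scalar ordinary differential equations $a_0(x)y^{(n)}+a_1(x)y^{(n-1)}+\dots+a_n(x)y=0$ for $y=y(x)$ with $a_0$ nowhere zero; two equations differing by multiplication by a nowhere vanishing function of $x$ are regarded as the same equation. Iterative equations: let $r$ (nowhere zero) and $s$ be smooth functions of $x$, and let $\Psi=r\frac{d}{dx}+s$, so $\Psi[y]=ry'+sy$. Put $\Psi^0=I$ (identity) and $\Psi^n[y]=\Psi^{n-1}(\Psi[y])$ for $n\ge 1$. A linear equation of order $n$ is called iterative if it is of the form $\Psi^n[y]=0$ for some such $r,s$. A point transformation is a locally invertible smooth change of variables between the independent and dependent variables $(x,y)$ and the new independent and dependent variables $(z,w)$. *)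

theory Defs
  imports "HOL-Analysis.Analysis"
begin

(* Continuous differentiability of order k on an open set S. The domain is finite-dimensional,
   so it suffices that every directional derivative is again of the preceding order. *)
primrec Ck_on :: "nat \<Rightarrow> 'a::euclidean_space set \<Rightarrow> ('a \<Rightarrow> 'b::real_normed_vector) \<Rightarrow> bool" where
  "Ck_on 0 S = (\<lambda>f. continuous_on S f)"
| "Ck_on (Suc k) S = (\<lambda>f. \<exists>f'. (\<forall>x\<in>S. (f has_derivative f' x) (at x)) \<and>
                                 (\<forall>v. Ck_on k S (\<lambda>x. f' x v)))"

definition smooth_on :: "'a::euclidean_space set \<Rightarrow> ('a \<Rightarrow> 'b::real_normed_vector) \<Rightarrow> bool" where
  "smooth_on S f \<longleftrightarrow> (\<forall>k. Ck_on k S f)"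

definition open_interval :: "real set \<Rightarrow> bool" where
  "open_interval J \<longleftrightarrow> open J \<and> is_interval J"

(* The equation a_0 y^(n) + a_1 y^(n-1) + ... + a_n y = 0 is represented by n and the
   coefficients a 0, ..., a n; the values a i with i > n are irrelevant. *)
definition linear_ode :: "real set \<Rightarrow> nat \<Rightarrow> (nat \<Rightarrow> real \<Rightarrow> real) \<Rightarrow> bool" where
  "linear_ode I n a \<longleftrightarrow> open_interval I \<and> (\<forall>i\<le>n. smooth_on I (a i)) \<and> (\<forall>x\<in>I. a 0 x \<noteq> 0)"

definition ode_lhs :: "nat \<Rightarrow> (nat \<Rightarrow> real \<Rightarrow> real) \<Rightarrow> (real \<Rightarrow> real) \<Rightarrow> real \<Rightarrow> real" where
  "ode_lhs n a y x = (\<Sum>i\<le>n. a i x * (deriv ^^ (n - i)) y x)"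

definition solves :: "nat \<Rightarrow> (nat \<Rightarrow> real \<Rightarrow> real) \<Rightarrow> real set \<Rightarrow> (real \<Rightarrow> real) \<Rightarrow> bool" where
  "solves n a J y \<longleftrightarrow> (\<forall>x\<in>J. ode_lhs n a y x = 0)"

definition iter_op :: "(real \<Rightarrow> real) \<Rightarrow> (real \<Rightarrow> real) \<Rightarrow> (real \<Rightarrow> real) \<Rightarrow> real \<Rightarrow> real" where
  "iter_op r s y = (\<lambda>x. r x * deriv y x + s x * y x)"

(* Equations are identified up to a nowhere vanishing factor c. The identity is required for all
   smooth y, solution or not, so it is an identity of differential operators on J. *)
definition iterative_on :: "real set \<Rightarrow> nat \<Rightarrow> (nat \<Rightarrow> real \<Rightarrow> real) \<Rightarrow> bool" where
  "iterative_on J n a \<longleftrightarrow>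
     (\<exists>r s c. smooth_on J r \<and> smooth_on J s \<and> smooth_on J c \<and>
        (\<forall>x\<in>J. r x \<noteq> 0) \<and> (\<forall>x\<in>J. c x \<noteq> 0) \<and>
        (\<forall>y. smooth_on J y \<longrightarrow>
           (\<forall>x\<in>J. (iter_op r s ^^ n) y x = c x * ode_lhs n a y x)))"

definition iterative_near :: "real set \<Rightarrow> nat \<Rightarrow> (nat \<Rightarrow> real \<Rightarrow> real) \<Rightarrow> real \<Rightarrow> bool" where
  "iterative_near I n a x0 \<longleftrightarrow>
     (\<exists>J. open_interval J \<and> x0 \<in> J \<and> J \<subseteq> I \<and> iterative_on J n a)"

(* \<Phi> (x, y) = (z, w), with both new variables depending on both old ones. *)
definition point_transformation ::
    "(real \<times> real) set \<Rightarrow> (real \<times> real \<Rightarrow> real \<times> real) \<Rightarrow> bool" where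
  "point_transformation U \<Phi> \<longleftrightarrow> open U \<and> open (\<Phi> ` U) \<and> smooth_on U \<Phi> \<and>
     (\<exists>\<Theta>. smooth_on (\<Phi> ` U) \<Theta> \<and> (\<forall>p\<in>U. \<Theta> (\<Phi> p) = p))"

definition graph_on :: "real set \<Rightarrow> (real \<Rightarrow> real) \<Rightarrow> (real \<times> real) set" where
  "graph_on J y = (\<lambda>x. (x, y x)) ` J"

(* The change of variables turns the function y on J into the function w on K. For such a pair,
   x \<mapsto> z is a diffeomorphism from J to K, as \<Phi> has a smooth inverse. *)
definition transforms_to ::
    "(real \<times> real) set \<Rightarrow> (real \<times> real \<Rightarrow> real \<times> real) \<Rightarrow>
     real set \<Rightarrow> (real \<Rightarrow> real) \<Rightarrow> real set \<Rightarrow> (real \<Rightarrow> real) \<Rightarrow> bool" where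
  "transforms_to U \<Phi> J y K w \<longleftrightarrow>
     open_interval J \<and> smooth_on J y \<and> open_interval K \<and> smooth_on K w \<and>
     graph_on J y \<subseteq> U \<and> \<Phi> ` graph_on J y = graph_on K w"

(* A function y that is transformed into a function w solves the given equation iff w^(n) = 0.
   Functions whose transformed graph has vertical tangents are not constrained, so some solution
   through p is required to be transformed into a function. For n >= 2 this is automatic. For
   n = 1 it excludes e.g. (z, w) = (y, x) for y' = 0, where no solution has an image of the form
   w = w(z) and the equivalence would hold vacuously. *)
definition reducible_near ::
    "real set \<Rightarrow> nat \<Rightarrow> (nat \<Rightarrow> real \<Rightarrow> real) \<Rightarrow> real \<times> real \<Rightarrow> bool" where
  "reducible_near I n a p \<longleftrightarrow>
     (\<exists>U \<Phi>. p \<in> U \<and> U \<subseteq> I \<times> UNIV \<and> point_transformation U \<Phi> \<and>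
        (\<forall>J y K w. transforms_to U \<Phi> J y K w \<longrightarrow>
           (solves n a J y \<longleftrightarrow> (\<forall>z\<in>K. (deriv ^^ n) w z = 0))) \<and>
        (\<exists>J y K w. transforms_to U \<Phi> J y K w \<and> p \<in> graph_on J y \<and> solves n a J y))"

end

theory Submission
  imports Defs
begin

text \<open>
  Why the theorem holds. Two facts carry it.

  The first is a conjugation identity (\<open>funpow_deriv_transport\<close>): a change of variables
  \<open>z = Z(x)\<close>, \<open>w = E(x) y\<close> turns \<open>d/dz\<close> into \<open>\<Psi> = r d/dx + s\<close> with \<open>r = 1/Z'\<close> and \<open>s = r E'/E\<close>, and so it turns
  \<open>w\<^sup>(\<^sup>n\<^sup>)\<close> into \<open>E \<Psi>\<^sup>n[y]\<close>. Given \<open>r\<close> and \<open>s\<close> one solves for \<open>Z\<close> and \<open>E\<close> by two integrations, which reduces an iterative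
  equation to the canonical form. Conversely, an equation with solutions \<open>Z\<^sup>k g\<close> for \<open>k < n\<close> is
  iterative (\<open>iterative_on_of_fundamental_system\<close>): for \<open>E = 1/g\<close> the operator \<open>\<Psi>\<^sup>n\<close> has the same \<open>n\<close> functions in its
  kernel, and an operator of order less than \<open>n\<close> that kills them all is zero.

  The second is that for \<open>n \<ge> 3\<close> a reducing point transformation \<open>\<Phi> = (Z, W)\<close> has no choice but to be of the
  form \<open>z = \<zeta>(x)\<close>, \<open>w = \<gamma>(x) y + h(x)\<close>. The proof plays the linear structures of the two solution
  spaces against each other. Solutions are obtained by pulling back polynomials of degree less
  than \<open>n\<close> (\<open>pull_back\<close>). Pulling back a line \<open>q\<close> and \<open>q + (z - z1)\<^sup>n\<^sup>-\<^sup>1\<close> gives solutions \<open>y\<close> and \<open>y + u\<close> with contact of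
  order \<open>n - 2\<close> at a point. The solutions \<open>y + t u\<close> are then carried to polynomials with the same
  contact with \<open>q\<close>, which can only be \<open>q + t (z - z1)\<^sup>n\<^sup>-\<^sup>1\<close> (\<open>family_identity\<close>). Differentiating
  \<open>W - q(Z) = t (Z - z1)\<^sup>n\<^sup>-\<^sup>1\<close> twice in \<open>t\<close> along \<open>y + t u\<close>, at \<open>t = 0\<close>, and letting \<open>x\<close> approach the
  contact point yields \<open>Z\<^sub>y = 0\<close>, and then \<open>W\<^sub>y\<^sub>y = 0\<close>. The argument needs \<open>n - 1 \<ge> 2\<close>, so that the curves
  \<open>y + t u\<close> are tangent at the contact point. Once \<open>\<Phi>\<close> has this form, the functions \<open>\<zeta>\<^sup>k / \<gamma>\<close> are solutions.

  For \<open>n = 2\<close> the transformation may mix the variables, as projective maps do, but two lines through one point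
  pull back to two independent solutions \<open>f\<close> and \<open>g\<close>, which for nonvanishing \<open>f\<close> are a fundamental
  system \<open>f, Z f\<close> with \<open>Z = g/f\<close>. For \<open>n = 1\<close> every equation is iterative.
\<close>

section \<open>Smooth functions\<close>

text \<open>Smoothness is defined through the regularity of the derivative along each fixed direction, one order
  at a time. The closure properties below are therefore all inductions on the order, with the
  usual differentiation rule as the induction step; descending by one order is what lets the
  undifferentiated factor of a product rule be fed to the induction hypothesis.\<close>

lemma Ck_on_Suc_imp_Ck_on: "Ck_on (Suc k) S f \<Longrightarrow> Ck_on k S f"
proof (induction k arbitrary: f)
  case 0
  then obtain f' where "\<forall>x\<in>S. (f has_derivative f' x) (at x)" by auto
  then show ?case
    by (auto intro!: continuous_at_imp_continuous_on has_derivative_continuous)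
next
  case (Suc k)
  then obtain f' where f': "\<forall>x\<in>S. (f has_derivative f' x) (at x)"
    "\<And>v. Ck_on (Suc k) S (\<lambda>x. f' x v)" by (auto simp del: Ck_on.simps simp: Ck_on.simps(2)[of "Suc k"])
  then have "\<And>v. Ck_on k S (\<lambda>x. f' x v)" using Suc.IH by blast
  with f' show ?case by auto
qed

lemma Ck_on_SucI:
  assumes "\<And>x. x \<in> S \<Longrightarrow> (f has_derivative f' x) (at x)" "\<And>v. Ck_on k S (\<lambda>x. f' x v)"
  shows "Ck_on (Suc k) S f"
  using assms by auto

lemma Ck_on_SucE:
  assumes "Ck_on (Suc k) S f"
  obtains f' where "\<And>x. x \<in> S \<Longrightarrow> (f has_derivative f' x) (at x)" "\<And>v. Ck_on k S (\<lambda>x. f' x v)"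
    "Ck_on k S f"
  using assms Ck_on_Suc_imp_Ck_on[OF assms] by auto

lemma Ck_on_subset: "Ck_on k S f \<Longrightarrow> T \<subseteq> S \<Longrightarrow> Ck_on k T f"
proof (induction k arbitrary: f)
  case 0
  then show ?case by (auto intro: continuous_on_subset)
next
  case (Suc k)
  from Suc.prems(1) obtain f' where "\<And>x. x \<in> S \<Longrightarrow> (f has_derivative f' x) (at x)"
    "\<And>v. Ck_on k S (\<lambda>x. f' x v)" by (rule Ck_on_SucE) blast
  then show ?case using Suc.IH Suc.prems(2) by (intro Ck_on_SucI[where f' = f']) auto
qed

lemma Ck_on_cong:
  assumes "open S" "\<And>x. x \<in> S \<Longrightarrow> f x = g x" "Ck_on k S f"
  shows "Ck_on k S g"
proof (cases k)
  case 0
  then show ?thesis using assms by (auto cong: continuous_on_cong)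
next
  case (Suc j)
  with assms obtain f' where f': "\<And>x. x \<in> S \<Longrightarrow> (f has_derivative f' x) (at x)"
    "\<And>v. Ck_on j S (\<lambda>x. f' x v)" by (metis Ck_on_SucE)
  have "(g has_derivative f' x) (at x)" if "x \<in> S" for x
    using f'(1)[OF that] assms(1,2) that by (auto intro: has_derivative_transform_within_open)
  then show ?thesis unfolding Suc by (intro Ck_on_SucI[where f' = f']) (use f' in auto)
qed

lemma Ck_on_const: "Ck_on k S (\<lambda>x. c)"
proof (induction k arbitrary: c)
  case (Suc k)
  show ?case by (rule Ck_on_SucI[where f' = "\<lambda>_ _. 0"]) (use Suc in auto)
qed auto

lemma Ck_on_bounded_linear_compose:
  assumes "bounded_linear h"
  shows "Ck_on k S f \<Longrightarrow> Ck_on k S (\<lambda>x. h (f x))"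
proof (induction k arbitrary: f)
  case 0
  then show ?case using assms by (auto intro: bounded_linear.continuous_on)
next
  case (Suc k)
  from Suc.prems(1) obtain f' where "\<And>x. x \<in> S \<Longrightarrow> (f has_derivative f' x) (at x)"
    "\<And>v. Ck_on k S (\<lambda>x. f' x v)" by (rule Ck_on_SucE) blast
  then show ?case using Suc.IH assms
    by (intro Ck_on_SucI[where f' = "\<lambda>x v. h (f' x v)"]) (auto intro: bounded_linear.has_derivative)
qed

lemma Ck_on_ident: "Ck_on k S (\<lambda>x. x)"
proof (cases k)
  case (Suc j)
  show ?thesis unfolding Suc by (rule Ck_on_SucI[where f' = "\<lambda>_ v. v"]) (auto intro: Ck_on_const)
qed auto

lemma Ck_on_add: "Ck_on k S f \<Longrightarrow> Ck_on k S g \<Longrightarrow> Ck_on k S (\<lambda>x. f x + g x)"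
proof (induction k arbitrary: f g)
  case 0
  then show ?case by (auto intro: continuous_intros)
next
  case (Suc k)
  from Suc.prems(1) obtain f' where f': "\<And>x. x \<in> S \<Longrightarrow> (f has_derivative f' x) (at x)"
    "\<And>v. Ck_on k S (\<lambda>x. f' x v)" by (rule Ck_on_SucE) blast
  from Suc.prems(2) obtain g' where g': "\<And>x. x \<in> S \<Longrightarrow> (g has_derivative g' x) (at x)"
    "\<And>v. Ck_on k S (\<lambda>x. g' x v)" by (rule Ck_on_SucE) blast
  show ?case using f' g' Suc.IH
    by (intro Ck_on_SucI[where f' = "\<lambda>x v. f' x v + g' x v"]) (auto intro: has_derivative_add)
qed

lemma Ck_on_sum: "(\<And>i. i \<in> A \<Longrightarrow> Ck_on k S (f i)) \<Longrightarrow> Ck_on k S (\<lambda>x. \<Sum>i\<in>A. f i x)"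
  by (induction A rule: infinite_finite_induct) (auto intro: Ck_on_const Ck_on_add)

lemma Ck_on_bounded_bilinear:
  assumes "bounded_bilinear bop"
  shows "Ck_on k S f \<Longrightarrow> Ck_on k S g \<Longrightarrow> Ck_on k S (\<lambda>x. bop (f x) (g x))"
proof (induction k arbitrary: f g)
  case 0
  then show ?case using assms by (auto intro: bounded_bilinear.continuous_on)
next
  case (Suc k)
  from Suc.prems(1) obtain f' where f': "\<And>x. x \<in> S \<Longrightarrow> (f has_derivative f' x) (at x)"
    "\<And>v. Ck_on k S (\<lambda>x. f' x v)" "Ck_on k S f" by (rule Ck_on_SucE) blast
  from Suc.prems(2) obtain g' where g': "\<And>x. x \<in> S \<Longrightarrow> (g has_derivative g' x) (at x)"
    "\<And>v. Ck_on k S (\<lambda>x. g' x v)" "Ck_on k S g" by (rule Ck_on_SucE) blast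
  show ?case using f' g' Suc.IH assms
    by (intro Ck_on_SucI[where f' = "\<lambda>x v. bop (f x) (g' x v) + bop (f' x v) (g x)"])
       (auto intro!: Ck_on_add intro: bounded_bilinear.FDERIV)
qed

text \<open>In the chain rule the direction \<open>f' x v\<close> in which \<open>g\<close> is differentiated moves with \<open>x\<close>, whereas the
  induction hypothesis speaks about \<open>g'\<close> along fixed directions. Expanding \<open>f' x v\<close> in the standard basis
  turns the derivative into a finite sum of products to which the hypothesis applies.\<close>

lemma Ck_on_compose:
  fixes f :: "'a::euclidean_space \<Rightarrow> 'b::euclidean_space"
  shows "Ck_on k T g \<Longrightarrow> Ck_on k S f \<Longrightarrow> f ` S \<subseteq> T \<Longrightarrow> Ck_on k S (\<lambda>x. g (f x))"
proof (induction k arbitrary: g)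
  case 0
  then show ?case by (auto intro: continuous_on_compose2)
next
  case (Suc k)
  from Suc.prems(2) obtain f' where f': "\<And>x. x \<in> S \<Longrightarrow> (f has_derivative f' x) (at x)"
    "\<And>v. Ck_on k S (\<lambda>x. f' x v)" "Ck_on k S f" by (rule Ck_on_SucE) blast
  from Suc.prems(1) obtain g' where g': "\<And>x. x \<in> T \<Longrightarrow> (g has_derivative g' x) (at x)"
    "\<And>v. Ck_on k T (\<lambda>x. g' x v)" "Ck_on k T g" by (rule Ck_on_SucE) blast
  have d: "((\<lambda>x. g (f x)) has_derivative
      (\<lambda>v. \<Sum>b\<in>Basis. (f' x v \<bullet> b) *\<^sub>R g' (f x) b)) (at x)" if "x \<in> S" for x
  proof -
    have gd: "(g has_derivative g' (f x)) (at (f x))" using g'(1) Suc.prems(3) that by blast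
    have "linear (g' (f x))" using gd has_derivative_linear by blast
    then have "g' (f x) (\<Sum>b\<in>Basis. (w \<bullet> b) *\<^sub>R b) = (\<Sum>b\<in>Basis. (w \<bullet> b) *\<^sub>R g' (f x) b)" for w
      by (simp add: linear_sum linear_scale)
    then have "(\<lambda>v. g' (f x) (f' x v)) = (\<lambda>v. \<Sum>b\<in>Basis. (f' x v \<bullet> b) *\<^sub>R g' (f x) b)"
      unfolding euclidean_representation by (intro ext)
    with has_derivative_compose[OF f'(1)[OF that] gd] show ?thesis by metis
  qed
  have "Ck_on k S (\<lambda>x. \<Sum>b\<in>Basis. (f' x v \<bullet> b) *\<^sub>R g' (f x) b)" for v
    using Suc.IH[OF g'(2) f'(3) Suc.prems(3)] f'(2)
    by (intro Ck_on_sum Ck_on_bounded_bilinear[OF bounded_bilinear_scaleR]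
        Ck_on_bounded_linear_compose[OF bounded_linear_inner_left]) auto
  with d show ?case by (intro Ck_on_SucI) auto
qed

lemma Ck_on_inverse: "Ck_on k (- {0}) (inverse :: real \<Rightarrow> real)"
proof (induction k)
  case 0
  then show ?case by (auto intro: continuous_intros)
next
  case (Suc k)
  show ?case
    by (rule Ck_on_SucI[where f' = "\<lambda>x v. - (inverse x * v * inverse x)"])
       (auto intro!: has_derivative_inverse' Suc Ck_on_const Ck_on_bounded_bilinear[OF bounded_bilinear_mult]
         Ck_on_bounded_linear_compose[OF bounded_linear_minus[OF bounded_linear_ident]])
qed

lemma Ck_on_exp: "Ck_on k S (exp :: real \<Rightarrow> real)"
proof (induction k)
  case 0
  then show ?case by (auto intro: continuous_intros)
next
  case (Suc k)
  have *: "(exp has_derivative (\<lambda>v. exp x * v)) (at x)" for x :: real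
    using DERIV_exp[of x] by (simp add: has_field_derivative_def)
  show ?case
    by (rule Ck_on_SucI[where f' = "\<lambda>x v. exp x * v"])
       (auto intro!: * Suc Ck_on_const Ck_on_bounded_bilinear[OF bounded_bilinear_mult])
qed

lemma smooth_on_subset: "smooth_on S f \<Longrightarrow> T \<subseteq> S \<Longrightarrow> smooth_on T f"
  unfolding smooth_on_def using Ck_on_subset by blast

lemma smooth_on_cong: "open S \<Longrightarrow> (\<And>x. x \<in> S \<Longrightarrow> f x = g x) \<Longrightarrow> smooth_on S f \<Longrightarrow> smooth_on S g"
  unfolding smooth_on_def using Ck_on_cong by blast

lemma smooth_on_const: "smooth_on S (\<lambda>x. c)"
  by (simp add: smooth_on_def Ck_on_const)

lemma smooth_on_ident: "smooth_on S (\<lambda>x. x)"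
  by (simp add: smooth_on_def Ck_on_ident)

lemma smooth_on_bounded_linear_compose:
  "bounded_linear h \<Longrightarrow> smooth_on S f \<Longrightarrow> smooth_on S (\<lambda>x. h (f x))"
  by (simp add: smooth_on_def Ck_on_bounded_linear_compose)

lemma smooth_on_fst: "smooth_on S f \<Longrightarrow> smooth_on S (\<lambda>x. fst (f x))"
  by (rule smooth_on_bounded_linear_compose[OF bounded_linear_fst])

lemma smooth_on_snd: "smooth_on S f \<Longrightarrow> smooth_on S (\<lambda>x. snd (f x))"
  by (rule smooth_on_bounded_linear_compose[OF bounded_linear_snd])

lemma smooth_on_minus: "smooth_on S f \<Longrightarrow> smooth_on S (\<lambda>x. - f x)"
  by (rule smooth_on_bounded_linear_compose[OF bounded_linear_minus[OF bounded_linear_ident]])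

lemma smooth_on_add: "smooth_on S f \<Longrightarrow> smooth_on S g \<Longrightarrow> smooth_on S (\<lambda>x. f x + g x)"
  by (simp add: smooth_on_def Ck_on_add)

lemma smooth_on_diff: "smooth_on S f \<Longrightarrow> smooth_on S g \<Longrightarrow> smooth_on S (\<lambda>x. f x - g x)"
  using smooth_on_add[of S f "\<lambda>x. - g x"] smooth_on_minus by fastforce

lemma smooth_on_mult:
  fixes f :: "_ \<Rightarrow> real"
  shows "smooth_on S f \<Longrightarrow> smooth_on S g \<Longrightarrow> smooth_on S (\<lambda>x. f x * g x)"
  by (simp add: smooth_on_def Ck_on_bounded_bilinear[OF bounded_bilinear_mult])

lemma smooth_on_power:
  fixes f :: "_ \<Rightarrow> real"
  shows "smooth_on S f \<Longrightarrow> smooth_on S (\<lambda>x. f x ^ k)"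
  by (induction k) (auto intro: smooth_on_const smooth_on_mult)

lemma smooth_on_sum: "(\<And>i. i \<in> A \<Longrightarrow> smooth_on S (f i)) \<Longrightarrow> smooth_on S (\<lambda>x. \<Sum>i\<in>A. f i x)"
  by (simp add: smooth_on_def Ck_on_sum)

lemma smooth_on_Pair:
  assumes "smooth_on S f" "smooth_on S g"
  shows "smooth_on S (\<lambda>x. (f x, g x))"
proof -
  have "bounded_linear (\<lambda>a. (a, 0))" "bounded_linear (\<lambda>a. (0, a))"
    by (auto intro!: bounded_linear_Pair bounded_linear_ident bounded_linear_zero)
  from smooth_on_add[OF smooth_on_bounded_linear_compose[OF this(1) assms(1)]
      smooth_on_bounded_linear_compose[OF this(2) assms(2)]]
  show ?thesis by simp
qed

lemma smooth_on_compose: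
  fixes f :: "'a::euclidean_space \<Rightarrow> 'b::euclidean_space"
  shows "smooth_on T g \<Longrightarrow> smooth_on S f \<Longrightarrow> f ` S \<subseteq> T \<Longrightarrow> smooth_on S (\<lambda>x. g (f x))"
  using Ck_on_compose unfolding smooth_on_def by blast

lemma smooth_on_inverse:
  fixes f :: "_ \<Rightarrow> real"
  assumes "smooth_on S f" "\<And>x. x \<in> S \<Longrightarrow> f x \<noteq> 0"
  shows "smooth_on S (\<lambda>x. inverse (f x))"
  by (rule smooth_on_compose[where T = "- {0}"]) (use assms in \<open>auto simp: smooth_on_def Ck_on_inverse\<close>)

lemma smooth_on_divide:
  fixes f :: "_ \<Rightarrow> real"
  assumes "smooth_on S f" "smooth_on S g" "\<And>x. x \<in> S \<Longrightarrow> g x \<noteq> 0"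
  shows "smooth_on S (\<lambda>x. f x / g x)"
  unfolding divide_inverse by (intro smooth_on_mult smooth_on_inverse assms)

lemma smooth_on_exp:
  fixes f :: "_ \<Rightarrow> real"
  assumes "smooth_on S f"
  shows "smooth_on S (\<lambda>x. exp (f x))"
  by (rule smooth_on_compose[where T = UNIV]) (use assms in \<open>auto simp: smooth_on_def Ck_on_exp\<close>)

lemma smooth_on_imp_continuous_on: "smooth_on S f \<Longrightarrow> continuous_on S f"
  unfolding smooth_on_def by (metis Ck_on.simps(1))

lemma open_nonvanishing_set:
  fixes f :: "_ \<Rightarrow> real"
  assumes "open S" "smooth_on S f"
  shows "open {x \<in> S. f x \<noteq> 0}"
proof -
  have "{x \<in> S. f x \<noteq> 0} = S \<inter> f -` (- {0})" by auto
  moreover have "open (- {0 :: real})" by (simp add: open_Compl)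
  ultimately show ?thesis
    using continuous_open_preimage[OF smooth_on_imp_continuous_on[OF assms(2)] assms(1), of "- {0}"] by simp
qed

section \<open>Derivatives and diffeomorphisms on open sets\<close>

text \<open>Each order of differentiability may come with its own derivative; uniqueness of derivatives
  merges them into a single one that is smooth.\<close>

lemma smooth_on_has_derivativeE:
  assumes "smooth_on S f" "open S"
  obtains f' where "\<And>x. x \<in> S \<Longrightarrow> (f has_derivative f' x) (at x)" "\<And>v. smooth_on S (\<lambda>x. f' x v)"
proof -
  have "\<forall>k. \<exists>f'. (\<forall>x\<in>S. (f has_derivative f' x) (at x)) \<and> (\<forall>v. Ck_on k S (\<lambda>x. f' x v))"
    using assms unfolding smooth_on_def by (metis Ck_on.simps(2))
  then obtain F where F: "\<And>k x. x \<in> S \<Longrightarrow> (f has_derivative F k x) (at x)"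
    "\<And>k v. Ck_on k S (\<lambda>x. F k x v)" by metis
  have "F k x = F 0 x" if "x \<in> S" for k x
    using F(1)[OF that] has_derivative_unique by blast
  then have "smooth_on S (\<lambda>x. F 0 x v)" for v
    unfolding smooth_on_def using Ck_on_cong[OF assms(2) _ F(2)] by metis
  with F(1) show ?thesis using that by blast
qed

lemma smooth_on_DERIV:
  fixes f :: "real \<Rightarrow> real"
  assumes "smooth_on S f" "open S"
  shows "x \<in> S \<Longrightarrow> (f has_real_derivative deriv f x) (at x)" and "smooth_on S (deriv f)"
proof -
  obtain f' where f': "\<And>x. x \<in> S \<Longrightarrow> (f has_derivative f' x) (at x)" "\<And>v. smooth_on S (\<lambda>x. f' x v)"
    using smooth_on_has_derivativeE[OF assms] by blast
  have d: "(f has_real_derivative f' x 1) (at x)" if "x \<in> S" for x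
    using f'(1)[OF that] has_derivative_imp_has_field_derivative has_derivative_bounded_linear
    by (metis (no_types, lifting) linear_simps(5) mult.commute real_scaleR_def mult.right_neutral)
  then have e: "deriv f x = f' x 1" if "x \<in> S" for x using that DERIV_imp_deriv by blast
  show "x \<in> S \<Longrightarrow> (f has_real_derivative deriv f x) (at x)" using d e by metis
  show "smooth_on S (deriv f)" using smooth_on_cong[OF assms(2) _ f'(2)[of 1]] e by metis
qed

lemma smooth_on_funpow_deriv:
  fixes f :: "real \<Rightarrow> real"
  assumes "smooth_on S f" "open S"
  shows "smooth_on S ((deriv ^^ k) f)"
  by (induction k) (use assms smooth_on_DERIV(2) in auto)

lemma Ck_on_Suc_DERIV:
  fixes f :: "real \<Rightarrow> real"
  assumes "\<And>x. x \<in> S \<Longrightarrow> (f has_real_derivative f' x) (at x)" "Ck_on k S f'"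
  shows "Ck_on (Suc k) S f"
  by (rule Ck_on_SucI[where f' = "\<lambda>x v. f' x * v"])
     (use assms in \<open>auto simp: has_field_derivative_def
        intro!: Ck_on_bounded_bilinear[OF bounded_bilinear_mult] Ck_on_const\<close>)

lemma smooth_on_of_DERIV:
  fixes f :: "real \<Rightarrow> real"
  assumes "\<And>x. x \<in> S \<Longrightarrow> (f has_real_derivative f' x) (at x)" "smooth_on S f'"
  shows "smooth_on S f"
  unfolding smooth_on_def using Ck_on_Suc_DERIV[of S f f'] assms Ck_on_Suc_imp_Ck_on
  unfolding smooth_on_def by blast

lemma funpow_deriv_cong_open:
  fixes f g :: "real \<Rightarrow> real"
  assumes "open S" "\<And>x. x \<in> S \<Longrightarrow> f x = g x" "x \<in> S"
  shows "(deriv ^^ k) f x = (deriv ^^ k) g x"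
  using assms(3)
proof (induction k arbitrary: x)
  case (Suc k)
  have "eventually (\<lambda>x. (deriv ^^ k) f x = (deriv ^^ k) g x) (nhds x)"
    using Suc assms(1) by (auto simp: eventually_nhds)
  then show ?case by (simp add: deriv_cong_ev)
qed (use assms in auto)

lemma open_intervalE:
  assumes "open J" "x0 \<in> J"
  obtains J' where "open_interval J'" "x0 \<in> J'" "J' \<subseteq> J"
proof -
  obtain e where "e > 0" "ball x0 e \<subseteq> J" using assms open_contains_ball by blast
  then show ?thesis using that[of "ball x0 e"] is_interval_ball_real by (auto simp: open_interval_def)
qed

text \<open>Rolle's theorem makes \<open>Z\<close> injective, invariance of domain makes its image open, and the
  formula \<open>X' = 1 / (Z' \<circ> X)\<close> raises the regularity of the inverse \<open>X\<close> by one order at a time.\<close>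

lemma interval_diffeomorphism:
  fixes Z :: "real \<Rightarrow> real"
  assumes J: "open_interval J" and Z: "smooth_on J Z" and Z': "\<And>x. x \<in> J \<Longrightarrow> deriv Z x \<noteq> 0"
  obtains X where "open_interval (Z ` J)" "smooth_on (Z ` J) X" "\<And>x. x \<in> J \<Longrightarrow> X (Z x) = x"
proof -
  have oJ: "open J" and iJ: "is_interval J" using J by (auto simp: open_interval_def)
  note D = smooth_on_DERIV(1)[OF Z oJ]
  have cZ: "continuous_on J Z" using Z by (rule smooth_on_imp_continuous_on)
  have ne: "Z u \<noteq> Z v" if uv: "u \<in> J" "v \<in> J" "u < v" for u v
  proof
    assume eq: "Z u = Z v"
    have sub: "{u..v} \<subseteq> J" using iJ uv unfolding is_interval_1 by (meson atLeastAtMost_iff subsetI)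
    have "\<exists>z. u < z \<and> z < v \<and> (Z has_real_derivative 0) (at z)"
    proof -
      have "continuous_on {u..v} Z" using cZ sub continuous_on_subset by blast
      moreover have "Z differentiable (at x)" if "u < x" "x < v" for x
        using D[of x] sub that by (auto simp: real_differentiable_def subset_iff)
      ultimately show ?thesis by (rule Rolle[OF uv(3) eq])
    qed
    then obtain z where "u < z" "z < v" "(Z has_real_derivative 0) (at z)" by blast
    then show False using Z'[of z] sub DERIV_imp_deriv[of Z 0 z] by (simp add: subset_iff)
  qed
  have inj: "inj_on Z J" 
  proof (rule inj_onI)
    fix u v assume "u \<in> J" "v \<in> J" "Z u = Z v"
    then show "u = v" using ne[of u v] ne[of v u] by (cases u v rule: linorder_cases) auto
  qed
  define X where "X = the_inv_into J Z"
  have X: "X (Z x) = x" if "x \<in> J" for x unfolding X_def using the_inv_into_f_f[OF inj that] .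
  have oK: "open (Z ` J)" using invariance_of_domain[OF cZ oJ inj] .
  have "is_interval (Z ` J)"
    using connected_continuous_image[OF cZ] iJ unfolding is_interval_connected_1 by blast
  then have K: "open_interval (Z ` J)" using oK by (simp add: open_interval_def)
  have dX: "(X has_real_derivative inverse (deriv Z x)) (at (Z x))" if "x \<in> J" for x
  proof -
    have "(X has_derivative (\<lambda>h. inverse (deriv Z x) * h)) (at (Z x))"
    proof (rule has_derivative_inverse_strong[OF oJ that cZ])
      show "(Z has_derivative (\<lambda>h. deriv Z x * h)) (at x)"
        using D[OF that] by (simp add: has_field_derivative_def)
      show "(\<lambda>h. deriv Z x * h) \<circ> (\<lambda>h. inverse (deriv Z x) * h) = id"
        using Z'[OF that] by (simp add: fun_eq_iff)
    qed (rule X)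
    then show ?thesis by (simp add: has_field_derivative_def)
  qed
  have dX': "(X has_real_derivative inverse (deriv Z (X z))) (at z)" if "z \<in> Z ` J" for z
  proof -
    from that obtain x where "x \<in> J" "z = Z x" by blast
    then show ?thesis using dX[of x] X[of x] by simp
  qed
  have s: "smooth_on J (\<lambda>x. inverse (deriv Z x))"
    by (intro smooth_on_inverse smooth_on_DERIV(2) Z oJ Z')
  have "Ck_on k (Z ` J) X" for k
  proof (induction k)
    case 0
    have "isCont X z" if "z \<in> Z ` J" for z using dX'[OF that] by (rule DERIV_isCont)
    then show ?case by (simp add: continuous_at_imp_continuous_on)
  next
    case (Suc k)
    show ?case
    proof (rule Ck_on_Suc_DERIV[OF dX'])
      show "Ck_on k (Z ` J) (\<lambda>x. inverse (deriv Z (X x)))"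
        by (rule Ck_on_compose[where T = J, OF _ Suc]) (use s in \<open>auto simp: smooth_on_def X\<close>)
    qed
  qed
  then have "smooth_on (Z ` J) X" by (simp add: smooth_on_def)
  from K this X show ?thesis by (rule that)
qed

lemma smooth_antiderivative_near:
  fixes f :: "real \<Rightarrow> real"
  assumes "open J" "smooth_on J f" "x0 \<in> J"
  obtains J' F where "open_interval J'" "x0 \<in> J'" "J' \<subseteq> J" "smooth_on J' F"
    "\<And>x. x \<in> J' \<Longrightarrow> (F has_real_derivative f x) (at x)"
proof -
  obtain e where e: "e > 0" "cball x0 e \<subseteq> J" using assms open_contains_cball by blast
  then have sub: "{x0 - e..x0 + e} \<subseteq> J" by (simp add: cball_eq_atLeastAtMost)
  have "continuous_on {x0 - e..x0 + e} f"
    using sub assms(2) smooth_on_imp_continuous_on continuous_on_subset by blast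
  then obtain F where F: "\<And>x. x \<in> {x0 - e..x0 + e} \<Longrightarrow>
      (F has_vector_derivative f x) (at x within {x0 - e..x0 + e})"
    using antiderivative_continuous by blast
  define J' where "J' = {x0 - e<..<x0 + e}"
  have D: "(F has_real_derivative f x) (at x)" if "x \<in> J'" for x
  proof -
    have "(F has_vector_derivative f x) (at x within J')"
      using F[of x] that by (auto simp: J'_def intro: has_vector_derivative_within_subset)
    then show ?thesis
      using that at_within_open[of x J'] by (simp add: J'_def has_real_derivative_iff_has_vector_derivative)
  qed
  have "smooth_on J' f" by (rule smooth_on_subset[OF assms(2)]) (use sub in \<open>auto simp: J'_def\<close>)
  with D have "smooth_on J' F" by (rule smooth_on_of_DERIV)
  moreover have "open_interval J'" "x0 \<in> J'" "J' \<subseteq> J"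
    using e sub by (auto simp: J'_def open_interval_def is_interval_oo)
  ultimately show ?thesis using D that by metis
qed

section \<open>Linear differential operators\<close>

lemma smooth_on_poly: "smooth_on S (poly p :: real \<Rightarrow> real)"
  by (induction p) (auto intro!: smooth_on_const smooth_on_add smooth_on_mult smooth_on_ident)

lemma funpow_deriv_poly: "(deriv ^^ n) (poly p) = poly ((pderiv ^^ n) p :: real poly)"
proof (induction n)
  case (Suc n)
  have "deriv (poly q) = poly (pderiv q)" for q :: "real poly"
    by (intro ext DERIV_imp_deriv poly_DERIV)
  with Suc show ?case by simp
qed simp

lemma funpow_pderiv_eq_0: "degree p < n \<Longrightarrow> (pderiv ^^ n) (p :: real poly) = 0"
proof (induction n arbitrary: p)
  case (Suc n)
  have "(pderiv ^^ n) (pderiv p) = 0"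
  proof (cases "pderiv p = 0")
    case True
    then show ?thesis by (induction n) auto
  next
    case False
    then have "degree p \<noteq> 0" using pderiv_eq_0_iff by blast
    then show ?thesis using Suc by (simp add: degree_pderiv)
  qed
  then show ?case by (simp add: funpow_swap1)
qed simp

lemma funpow_deriv_poly_eq_0: "degree (p :: real poly) < n \<Longrightarrow> (deriv ^^ n) (poly p) z = 0"
  by (simp add: funpow_deriv_poly funpow_pderiv_eq_0)

lemma funpow_deriv_add:
  fixes f g :: "real \<Rightarrow> real"
  assumes "open J" "smooth_on J f" "smooth_on J g" "x \<in> J"
  shows "(deriv ^^ k) (\<lambda>x. f x + g x) x = (deriv ^^ k) f x + (deriv ^^ k) g x"
  using assms(4)
proof (induction k arbitrary: x)
  case (Suc k)
  note D = smooth_on_DERIV(1)[OF smooth_on_funpow_deriv[OF _ assms(1)] assms(1) Suc.prems]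
  have "deriv ((deriv ^^ k) (\<lambda>x. f x + g x)) x = deriv (\<lambda>x. (deriv ^^ k) f x + (deriv ^^ k) g x) x"
    using funpow_deriv_cong_open[OF assms(1) Suc.IH Suc.prems, where k = 1] by simp
  also have "\<dots> = deriv ((deriv ^^ k) f) x + deriv ((deriv ^^ k) g) x"
    by (intro DERIV_imp_deriv DERIV_add D assms)
  finally show ?case by simp
qed simp

lemma funpow_deriv_cmult:
  fixes f :: "real \<Rightarrow> real"
  assumes "open J" "smooth_on J f" "x \<in> J"
  shows "(deriv ^^ k) (\<lambda>x. c * f x) x = c * (deriv ^^ k) f x"
  using assms(3)
proof (induction k arbitrary: x)
  case (Suc k)
  note D = smooth_on_DERIV(1)[OF smooth_on_funpow_deriv[OF _ assms(1)] assms(1) Suc.prems]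
  have "deriv ((deriv ^^ k) (\<lambda>x. c * f x)) x = deriv (\<lambda>x. c * (deriv ^^ k) f x) x"
    using funpow_deriv_cong_open[OF assms(1) Suc.IH Suc.prems, where k = 1] by simp
  also have "\<dots> = c * deriv ((deriv ^^ k) f) x"
    by (intro DERIV_imp_deriv DERIV_cmult D assms)
  finally show ?case by simp
qed simp

lemma ode_lhs_add:
  assumes "open J" "smooth_on J f" "smooth_on J g" "x \<in> J"
  shows "ode_lhs n a (\<lambda>x. f x + g x) x = ode_lhs n a f x + ode_lhs n a g x"
  by (simp add: ode_lhs_def funpow_deriv_add[OF assms] sum.distrib distrib_left)

lemma ode_lhs_cmult:
  assumes "open J" "smooth_on J f" "x \<in> J"
  shows "ode_lhs n a (\<lambda>x. c * f x) x = c * ode_lhs n a f x"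
  by (simp add: ode_lhs_def funpow_deriv_cmult[OF assms] sum_distrib_left mult.left_commute)

lemma ode_lhs_cong:
  assumes "open J" "\<And>x. x \<in> J \<Longrightarrow> f x = g x" "x \<in> J"
  shows "ode_lhs n a f x = ode_lhs n a g x"
  unfolding ode_lhs_def using funpow_deriv_cong_open[OF assms] by simp

lemma solves_add:
  assumes "open J" "smooth_on J f" "smooth_on J g" "solves n a J f" "solves n a J g"
  shows "solves n a J (\<lambda>x. f x + g x)"
  using assms ode_lhs_add[OF assms(1-3)] by (simp add: solves_def)

lemma solves_cmult:
  assumes "open J" "smooth_on J f" "solves n a J f"
  shows "solves n a J (\<lambda>x. c * f x)"
  using assms ode_lhs_cmult[OF assms(1,2)] by (simp add: solves_def)

lemma solves_diff:
  assumes "open J" "smooth_on J f" "smooth_on J g" "solves n a J f" "solves n a J g"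
  shows "solves n a J (\<lambda>x. f x - g x)"
  using solves_add[OF assms(1,2) _ assms(4) solves_cmult[OF assms(1,3,5), of "-1"]]
    smooth_on_minus[OF assms(3)] by simp

lemma solves_cong:
  assumes "open J" "\<And>x. x \<in> J \<Longrightarrow> f x = g x" "solves n a J f"
  shows "solves n a J g"
  using assms ode_lhs_cong[OF assms(1,2)] by (simp add: solves_def)

lemma solves_sum:
  assumes "open J" "finite A"
  shows "(\<And>i. i \<in> A \<Longrightarrow> smooth_on J (f i)) \<Longrightarrow> (\<And>i. i \<in> A \<Longrightarrow> solves n a J (f i)) \<Longrightarrow>
    solves n a J (\<lambda>x. \<Sum>i\<in>A. f i x)"
  using assms(2)
proof (induction A rule: finite_induct)
  case empty
  have "(deriv ^^ k) (\<lambda>x. 0 :: real) = (\<lambda>x. 0)" for k by (induction k) auto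
  then show ?case by (simp add: solves_def ode_lhs_def)
next
  case (insert i A)
  then show ?case by (auto intro!: solves_add[OF assms(1)] smooth_on_sum)
qed

lemma solves_subset: "solves n a J y \<Longrightarrow> J' \<subseteq> J \<Longrightarrow> solves n a J' y"
  by (auto simp: solves_def)

text \<open>The computational core of both directions. If \<open>r Z' = 1\<close> and \<open>r E' = s E\<close>, then the change of variables
  \<open>z = Z(x)\<close>, \<open>w = E(x) y\<close> satisfies \<open>dw/dz = r (E y)' = E (r y' + s y)\<close>: it conjugates \<open>d/dz\<close> into the
  first order operator \<open>\<Psi> = r d/dx + s\<close>, and hence \<open>d\<^sup>n/dz\<^sup>n\<close> into \<open>\<Psi>\<^sup>n\<close>.\<close>

lemma funpow_deriv_transport:
  assumes J: "open J" and K: "open K" "Z ` J \<subseteq> K"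
    and Z: "smooth_on J Z" and E: "smooth_on J E" and r: "smooth_on J r" and s: "smooth_on J s"
    and rZ: "\<And>x. x \<in> J \<Longrightarrow> r x * deriv Z x = 1"
    and rE: "\<And>x. x \<in> J \<Longrightarrow> r x * deriv E x = s x * E x"
  shows "smooth_on K w \<Longrightarrow> smooth_on J y \<Longrightarrow> (\<And>x. x \<in> J \<Longrightarrow> w (Z x) = E x * y x) \<Longrightarrow> x \<in> J \<Longrightarrow>
    (deriv ^^ n) w (Z x) = E x * (iter_op r s ^^ n) y x"
proof (induction n arbitrary: w y)
  case (Suc n)
  have "deriv w (Z x) = E x * iter_op r s y x" if x: "x \<in> J" for x
  proof -
    have "((\<lambda>x. w (Z x)) has_real_derivative deriv w (Z x) * deriv Z x) (at x)"
      by (rule DERIV_chain2) (use x K in \<open>auto intro!: smooth_on_DERIV(1)[OF Suc.prems(1)] smooth_on_DERIV(1)[OF Z J]\<close>)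
    moreover have "((\<lambda>x. E x * y x) has_real_derivative deriv E x * y x + deriv y x * E x) (at x)"
      by (intro DERIV_mult smooth_on_DERIV(1)[OF E J x] smooth_on_DERIV(1)[OF Suc.prems(2) J x])
    then have "((\<lambda>x. w (Z x)) has_real_derivative deriv E x * y x + deriv y x * E x) (at x)"
      by (rule has_field_derivative_transform_within_open[OF _ J x]) (simp add: Suc.prems(3))
    ultimately have e: "deriv w (Z x) * deriv Z x = deriv E x * y x + deriv y x * E x"
      by (rule DERIV_unique)
    have "deriv w (Z x) = deriv w (Z x) * (r x * deriv Z x)" using rZ[OF x] by simp
    also have "\<dots> = r x * (deriv w (Z x) * deriv Z x)" by (simp add: mult_ac)
    also have "\<dots> = (r x * deriv E x) * y x + E x * (r x * deriv y x)"
      unfolding e by (simp add: algebra_simps)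
    also have "\<dots> = E x * iter_op r s y x" unfolding rE[OF x] iter_op_def by (simp add: algebra_simps)
    finally show ?thesis .
  qed
  moreover have "smooth_on K (deriv w)" "smooth_on J (iter_op r s y)"
    unfolding iter_op_def
    by (auto intro!: smooth_on_add smooth_on_mult r s smooth_on_DERIV(2) Suc.prems K J)
  ultimately have "(deriv ^^ n) (deriv w) (Z x) = E x * (iter_op r s ^^ n) (iter_op r s y) x"
    using Suc.IH[of "deriv w" "iter_op r s y"] Suc.prems(4) by blast
  then show ?case by (simp add: funpow_swap1)
qed simp

text \<open>At a point, \<open>\<Psi>\<^sup>n[y]\<close> depends on the \<open>n\<close>-jet of \<open>y\<close> only. Having the coefficients on a fixed interval, valid
  for functions on any smaller one, makes the comparison with a given equation a question about
  coefficients at a point.\<close>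

lemma iter_op_power_eq_ode_lhs:
  assumes J: "open J" and r: "smooth_on J r" and s: "smooth_on J s"
  obtains b where "\<And>i. smooth_on J (b i)" "\<And>x. b 0 x = r x ^ n"
    "\<And>J' y x. open J' \<Longrightarrow> J' \<subseteq> J \<Longrightarrow> smooth_on J' y \<Longrightarrow> x \<in> J' \<Longrightarrow>
       (iter_op r s ^^ n) y x = ode_lhs n b y x"
proof -
  have "\<exists>b. (\<forall>i. smooth_on J (b i)) \<and> (\<forall>x. b 0 x = r x ^ n) \<and>
    (\<forall>J' y x. open J' \<longrightarrow> J' \<subseteq> J \<longrightarrow> smooth_on J' y \<longrightarrow> x \<in> J' \<longrightarrow>
       (iter_op r s ^^ n) y x = ode_lhs n b y x)"
  proof (induction n)
    case 0
    show ?case by (rule exI[of _ "\<lambda>_ _. 1"]) (auto simp: ode_lhs_def smooth_on_const)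
  next
    case (Suc n)
    then obtain b where b: "\<And>i. smooth_on J (b i)" "\<And>x. b 0 x = r x ^ n"
      "\<And>J' y x. open J' \<Longrightarrow> J' \<subseteq> J \<Longrightarrow> smooth_on J' y \<Longrightarrow> x \<in> J' \<Longrightarrow>
       (iter_op r s ^^ n) y x = ode_lhs n b y x" by blast
    \<comment> \<open>The derivative of the term with index \<open>i\<close> contributes to index \<open>i\<close> when it falls on \<open>y\<close>
        and to index \<open>i + 1\<close> when it falls on the coefficient.\<close>
    define b' where "b' i x = (if i \<le> n then r x * b i x else 0) +
      (if i = 0 then 0 else r x * deriv (b (i - 1)) x + s x * b (i - 1) x)" for i x
    have sm: "smooth_on J (b' i)" for i
    proof -
      have "smooth_on J (\<lambda>x. if i \<le> n then r x * b i x else 0)"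
        by (cases "i \<le> n") (auto intro!: smooth_on_const smooth_on_mult r b)
      moreover have "smooth_on J (\<lambda>x. if i = 0 then 0 else r x * deriv (b (i - 1)) x + s x * b (i - 1) x)"
        by (cases "i = 0")
          (auto intro!: smooth_on_const smooth_on_add smooth_on_mult r s b smooth_on_DERIV(2)[OF b(1) J])
      ultimately show ?thesis unfolding b'_def by (rule smooth_on_add)
    qed
    have "(iter_op r s ^^ Suc n) y x = ode_lhs (Suc n) b' y x"
      if J': "open J'" "J' \<subseteq> J" and y: "smooth_on J' y" and x: "x \<in> J'" for J' y x
    proof -
      have "deriv ((iter_op r s ^^ n) y) x = deriv (ode_lhs n b y) x"
        using funpow_deriv_cong_open[OF J'(1) b(3)[OF J' y] x, where k = 1] by simp
      also have "\<dots> = (\<Sum>i\<le>n. deriv (b i) x * (deriv ^^ (n - i)) y x + (deriv ^^ Suc (n - i)) y x * b i x)"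
      proof (rule DERIV_imp_deriv)
        have "(b i has_real_derivative deriv (b i) x) (at x)" for i
          using smooth_on_DERIV(1)[OF b(1) J] x J'(2) by blast
        moreover have "((deriv ^^ k) y has_real_derivative (deriv ^^ Suc k) y x) (at x)" for k
          using smooth_on_DERIV(1)[OF smooth_on_funpow_deriv[OF y J'(1)] J'(1) x] by simp
        ultimately show "(ode_lhs n b y has_real_derivative (\<Sum>i\<le>n. deriv (b i) x * (deriv ^^ (n - i)) y x +
            (deriv ^^ Suc (n - i)) y x * b i x)) (at x)"
          unfolding ode_lhs_def by (intro DERIV_sum DERIV_mult)
      qed
      finally have "(iter_op r s ^^ Suc n) y x =
          r x * (\<Sum>i\<le>n. deriv (b i) x * (deriv ^^ (n - i)) y x + (deriv ^^ Suc (n - i)) y x * b i x) +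
          s x * ode_lhs n b y x"
        using b(3)[OF J' y x] by (simp add: iter_op_def)
      also have "\<dots> = (\<Sum>i\<le>n. (r x * b i x) * (deriv ^^ (Suc n - i)) y x) +
          (\<Sum>i\<le>n. (r x * deriv (b i) x + s x * b i x) * (deriv ^^ (n - i)) y x)"
        unfolding ode_lhs_def sum_distrib_left sum.distrib[symmetric]
        by (intro sum.cong) (auto simp: algebra_simps Suc_diff_le)
      also have "(\<Sum>i\<le>n. (r x * b i x) * (deriv ^^ (Suc n - i)) y x) =
          (\<Sum>i\<le>Suc n. (if i \<le> n then r x * b i x else 0) * (deriv ^^ (Suc n - i)) y x)"
        by simp
      also have "(\<Sum>i\<le>n. (r x * deriv (b i) x + s x * b i x) * (deriv ^^ (n - i)) y x) =
          (\<Sum>i\<le>Suc n. (if i = 0 then 0 else r x * deriv (b (i - 1)) x + s x * b (i - 1) x) *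
            (deriv ^^ (Suc n - i)) y x)"
        by (subst sum.atMost_Suc_shift) simp
      finally show ?thesis
        unfolding ode_lhs_def b'_def distrib_right sum.distrib .
    qed
    moreover have "b' 0 x = r x ^ Suc n" for x by (simp add: b'_def b(2))
    ultimately show ?case using sm by blast
  qed
  then show ?thesis using that by metis
qed

text \<open>A differential operator vanishes at a point as soon as it kills, for each order \<open>k = n - i\<close>, a function that
  vanishes there to order exactly \<open>k\<close>: the resulting linear system for the coefficients is triangular.
  The first disjunct allows for coefficients known to be zero beforehand, such as a leading one removed by scaling.\<close>

lemma coeffs_eq_0_of_triangular_test_functions:
  assumes "\<And>i. i \<le> n \<Longrightarrow> b i x = 0 \<or> (\<exists>f. (\<forall>j<n - i. (deriv ^^ j) f x = 0) \<and>
     (deriv ^^ (n - i)) f x \<noteq> 0 \<and> ode_lhs n b f x = 0)"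
  shows "i \<le> n \<Longrightarrow> b i x = 0"
proof (induction i rule: less_induct)
  case (less i)
  show ?case
  proof (rule ccontr)
    assume ne: "b i x \<noteq> 0"
    with assms[OF less.prems] obtain f where f: "\<And>j. j < n - i \<Longrightarrow> (deriv ^^ j) f x = 0"
      "(deriv ^^ (n - i)) f x \<noteq> 0" "ode_lhs n b f x = 0" by blast
    have "b j x * (deriv ^^ (n - j)) f x = 0" if "j \<le> n" "j \<noteq> i" for j
    proof (cases "j < i")
      case True
      then show ?thesis using less.IH[OF True] that by simp
    next
      case False
      then have "n - j < n - i" using that less.prems by linarith
      then show ?thesis using f(1) by simp
    qed
    then have "(\<Sum>j\<in>{..n} - {i}. b j x * (deriv ^^ (n - j)) f x) = 0"
      by (intro sum.neutral ballI) (metis Diff_iff atMost_iff singletonI)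
    then have "ode_lhs n b f x = b i x * (deriv ^^ (n - i)) f x"
      unfolding ode_lhs_def using less.prems by (subst sum.remove[of _ i]) auto
    then show False using ne f by simp
  qed
qed

text \<open>Supplies the test functions: \<open>(Z - Z(x1))\<^sup>k h\<close> vanishes at \<open>x1\<close> to order exactly \<open>k\<close> when \<open>Z'\<close> and \<open>h\<close> do not
  vanish there.\<close>

lemma funpow_deriv_power_mult_at_zero:
  fixes Z :: "real \<Rightarrow> real"
  assumes J: "open J" "x1 \<in> J" and Z: "smooth_on J Z"
  shows "smooth_on J h \<Longrightarrow> (\<forall>j<k. (deriv ^^ j) (\<lambda>x. (Z x - Z x1) ^ k * h x) x1 = 0) \<and>
    (deriv ^^ k) (\<lambda>x. (Z x - Z x1) ^ k * h x) x1 = fact k * deriv Z x1 ^ k * h x1"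
proof (induction k arbitrary: h)
  case (Suc k)
  define h1 where "h1 x = real (Suc k) * deriv Z x * h x + (Z x - Z x1) * deriv h x" for x
  have h1: "smooth_on J h1" unfolding h1_def
    by (intro smooth_on_add smooth_on_mult smooth_on_diff smooth_on_const smooth_on_DERIV(2) Z J Suc.prems)
  have d: "deriv (\<lambda>x. (Z x - Z x1) ^ Suc k * h x) x = (Z x - Z x1) ^ k * h1 x" if "x \<in> J" for x
  proof -
    have "((\<lambda>x. Z x - Z x1) has_real_derivative deriv Z x) (at x)"
      using smooth_on_DERIV(1)[OF Z J(1) that] by (auto intro!: derivative_eq_intros)
    from DERIV_mult[OF DERIV_power_Suc[OF this, of k] smooth_on_DERIV(1)[OF Suc.prems J(1) that]]
    show ?thesis by (simp add: DERIV_imp_deriv h1_def algebra_simps)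
  qed
  have e: "(deriv ^^ Suc j) (\<lambda>x. (Z x - Z x1) ^ Suc k * h x) x1 =
      (deriv ^^ j) (\<lambda>x. (Z x - Z x1) ^ k * h1 x) x1" for j
    using funpow_deriv_cong_open[OF J(1) d J(2), where k = j] by (simp add: funpow_swap1)
  have "(deriv ^^ j) (\<lambda>x. (Z x - Z x1) ^ Suc k * h x) x1 = 0" if "j < Suc k" for j
  proof (cases j)
    case (Suc i)
    then show ?thesis using e[of i] Suc.IH[OF h1] that by simp
  qed simp
  moreover have "h1 x1 = real (Suc k) * deriv Z x1 * h x1" by (simp add: h1_def)
  ultimately show ?case using e[of k] Suc.IH[OF h1] by (simp add: algebra_simps)
qed simp

text \<open>An equation with solutions \<open>g, Z g, \<dots>, Z\<^sup>n\<^sup>-\<^sup>1 g\<close> is iterative. With \<open>r = 1/Z'\<close> and \<open>E = 1/g\<close>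
  the operator \<open>\<Psi>\<^sup>n\<close> is \<open>d\<^sup>n/dz\<^sup>n\<close> in the variables \<open>Z\<close> and \<open>E y\<close>, so it kills the same functions. After
  scaling, the difference of the two operators has order less than \<open>n\<close> and has these \<open>n\<close> functions
  in its kernel; the combinations \<open>(Z - Z(x))\<^sup>k g\<close> are triangular test functions at \<open>x\<close>.\<close>

lemma iterative_on_of_fundamental_system:
  assumes ode: "linear_ode I n a" and J: "open_interval J" "J \<subseteq> I"
    and Z: "smooth_on J Z" "\<And>x. x \<in> J \<Longrightarrow> deriv Z x \<noteq> 0"
    and g: "smooth_on J g" "\<And>x. x \<in> J \<Longrightarrow> g x \<noteq> 0"
    and sol: "\<And>k. k < n \<Longrightarrow> solves n a J (\<lambda>x. Z x ^ k * g x)"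
  shows "iterative_on J n a"
proof -
  have oJ: "open J" using J by (simp add: open_interval_def)
  have a: "smooth_on J (a i)" if "i \<le> n" for i
    using ode that by (intro smooth_on_subset[OF _ J(2)]) (simp add: linear_ode_def)
  have a0: "a 0 x \<noteq> 0" if "x \<in> J" for x using ode J(2) that by (auto simp: linear_ode_def)
  define E where "E x = inverse (g x)" for x
  define r where "r x = inverse (deriv Z x)" for x
  define s where "s x = r x * deriv E x * g x" for x
  have E: "smooth_on J E" unfolding E_def by (intro smooth_on_inverse g)
  have r: "smooth_on J r" unfolding r_def by (intro smooth_on_inverse smooth_on_DERIV(2) Z oJ)
  have s: "smooth_on J s" unfolding s_def by (intro smooth_on_mult r g smooth_on_DERIV(2) E oJ)
  obtain b where b: "\<And>i. smooth_on J (b i)" "\<And>x. b 0 x = r x ^ n"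
    "\<And>J' y x. open J' \<Longrightarrow> J' \<subseteq> J \<Longrightarrow> smooth_on J' y \<Longrightarrow> x \<in> J' \<Longrightarrow>
       (iter_op r s ^^ n) y x = ode_lhs n b y x"
    using iter_op_power_eq_ode_lhs[OF oJ r s] by metis
  \<comment> \<open>The factor is forced by the leading coefficients.\<close>
  define c where "c x = b 0 x / a 0 x" for x
  have rn: "r x \<noteq> 0" if "x \<in> J" for x using Z(2)[OF that] by (simp add: r_def)
  have eq: "b i x = c x * a i x" if x: "x \<in> J" and i: "i \<le> n" for x i
  proof -
    have lin: "ode_lhs n (\<lambda>i x. b i x - c x * a i x) f x = ode_lhs n b f x - c x * ode_lhs n a f x" for f
      by (simp add: ode_lhs_def left_diff_distrib sum_subtractf sum_distrib_left mult.assoc)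
    have "b i x - c x * a i x = 0"
    proof (rule coeffs_eq_0_of_triangular_test_functions[where b = "\<lambda>i x. b i x - c x * a i x" and n = n])
      fix i assume i: "i \<le> n"
      show "b i x - c x * a i x = 0 \<or> (\<exists>f. (\<forall>j<n - i. (deriv ^^ j) f x = 0) \<and>
        (deriv ^^ (n - i)) f x \<noteq> 0 \<and> ode_lhs n (\<lambda>i x. b i x - c x * a i x) f x = 0)"
      proof (cases "i = 0")
        case True
        then show ?thesis using a0[OF x] by (simp add: c_def)
      next
        case False
        define k where "k = n - i"
        have k: "k < n" using False i by (simp add: k_def)
        define p where "p = [:- Z x, 1:] ^ k"
        have dp: "degree p = k" unfolding p_def by (simp add: degree_linear_power)
        define f where "f t = (Z t - Z x) ^ k * g t" for t
        have fp: "f t = poly p (Z t) * g t" for t by (simp add: f_def p_def poly_power)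
        have smf: "smooth_on J f" unfolding f_def
          by (intro smooth_on_mult smooth_on_power smooth_on_diff smooth_on_const Z g)
        have "(deriv ^^ n) (poly p) (Z x) = E x * (iter_op r s ^^ n) f x"
        proof (rule funpow_deriv_transport[OF oJ open_UNIV _ Z(1) E r s])
          show "poly p (Z t) = E t * f t" if "t \<in> J" for t
            using g(2)[OF that] by (simp add: E_def fp)
        qed (use g(2) Z(2) x smf smooth_on_poly in \<open>auto simp: r_def s_def E_def\<close>)
        moreover have "(deriv ^^ n) (poly p) (Z x) = 0" using k dp by (simp add: funpow_deriv_poly_eq_0)
        moreover have "E x \<noteq> 0" using g(2)[OF x] by (simp add: E_def)
        ultimately have 1: "ode_lhs n b f x = 0" using b(3)[OF oJ subset_refl smf x] by simp
        have "solves n a J (\<lambda>t. \<Sum>i\<le>k. coeff p i * (Z t ^ i * g t))"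
          using k by (intro solves_sum oJ solves_cmult smooth_on_mult smooth_on_const smooth_on_power Z g sol) auto
        moreover have "(\<Sum>i\<le>k. coeff p i * (Z t ^ i * g t)) = f t" for t
          by (simp add: fp poly_altdef dp sum_distrib_right mult.assoc)
        ultimately have 2: "ode_lhs n a f x = 0" using x by (simp add: solves_def)
        have "ode_lhs n (\<lambda>i x. b i x - c x * a i x) f x = 0" unfolding lin 1 2 by simp
        moreover have "(\<forall>j<k. (deriv ^^ j) f x = 0)" "(deriv ^^ k) f x \<noteq> 0"
          using funpow_deriv_power_mult_at_zero[OF oJ x Z(1) g(1), of k] g(2)[OF x] Z(2)[OF x]
          unfolding f_def by auto
        ultimately show ?thesis unfolding k_def by blast
      qed
    qed (rule i)
    then show ?thesis by simp
  qed
  show ?thesis unfolding iterative_on_def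
  proof (intro exI conjI)
    show "smooth_on J r" by (rule r)
    show "smooth_on J s" by (rule s)
    show "smooth_on J c" unfolding c_def by (intro smooth_on_divide b a a0) auto
    show "\<forall>x\<in>J. r x \<noteq> 0" using rn by blast
    show "\<forall>x\<in>J. c x \<noteq> 0" using rn a0 b(2) by (simp add: c_def)
    show "\<forall>y. smooth_on J y \<longrightarrow> (\<forall>x\<in>J. (iter_op r s ^^ n) y x = c x * ode_lhs n a y x)"
    proof (intro allI impI ballI)
      fix y :: "real \<Rightarrow> real" and x assume y: "smooth_on J y" and x: "x \<in> J"
      have "(iter_op r s ^^ n) y x = ode_lhs n b y x" using b(3)[OF oJ subset_refl y x] .
      also have "\<dots> = c x * ode_lhs n a y x"
        unfolding ode_lhs_def sum_distrib_left by (intro sum.cong) (auto simp: eq[OF x])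
      finally show "(iter_op r s ^^ n) y x = c x * ode_lhs n a y x" .
    qed
  qed
qed

text \<open>An identity of operators tested on functions that are smooth on \<open>J\<close> also holds for functions on
  smaller intervals, which need not extend to \<open>J\<close>: polynomials determine the coefficients.\<close>

lemma iterative_on_local:
  assumes J: "open J" and r: "smooth_on J r" and s: "smooth_on J s"
    and eq: "\<And>y x. smooth_on J y \<Longrightarrow> x \<in> J \<Longrightarrow> (iter_op r s ^^ n) y x = c x * ode_lhs n a y x"
    and J': "open J'" "J' \<subseteq> J" and y: "smooth_on J' y" and x: "x \<in> J'"
  shows "(iter_op r s ^^ n) y x = c x * ode_lhs n a y x"
proof -
  obtain b where b: "\<And>i. smooth_on J (b i)" "\<And>x. b 0 x = r x ^ n"
    "\<And>J' y x. open J' \<Longrightarrow> J' \<subseteq> J \<Longrightarrow> smooth_on J' y \<Longrightarrow> x \<in> J' \<Longrightarrow>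
       (iter_op r s ^^ n) y x = ode_lhs n b y x"
    using iter_op_power_eq_ode_lhs[OF J r s] by metis
  have xJ: "x \<in> J" using x J' by blast
  have lin: "ode_lhs n (\<lambda>i x. b i x - c x * a i x) f x = ode_lhs n b f x - c x * ode_lhs n a f x" for f
    by (simp add: ode_lhs_def left_diff_distrib sum_subtractf sum_distrib_left mult.assoc)
  have "b i x - c x * a i x = 0" if "i \<le> n" for i
  proof (rule coeffs_eq_0_of_triangular_test_functions[where b = "\<lambda>i x. b i x - c x * a i x" and n = n])
    fix i
    define f where "f t = (t - x) ^ (n - i) * 1" for t :: real
    have f: "smooth_on J f" unfolding f_def
      by (intro smooth_on_mult smooth_on_power smooth_on_diff smooth_on_ident smooth_on_const)
    have "ode_lhs n (\<lambda>i x. b i x - c x * a i x) f x = 0"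
      unfolding lin using eq[OF f xJ] b(3)[OF J subset_refl f xJ] by simp
    moreover have "(\<forall>j<n - i. (deriv ^^ j) f x = 0)" "(deriv ^^ (n - i)) f x \<noteq> 0"
      using funpow_deriv_power_mult_at_zero[OF J xJ smooth_on_ident smooth_on_const[of _ 1], of "n - i"]
      unfolding f_def by auto
    ultimately show "b i x - c x * a i x = 0 \<or> (\<exists>f. (\<forall>j<n - i. (deriv ^^ j) f x = 0) \<and>
        (deriv ^^ (n - i)) f x \<noteq> 0 \<and> ode_lhs n (\<lambda>i x. b i x - c x * a i x) f x = 0)" by blast
  qed (rule that)
  then have "ode_lhs n b y x = c x * ode_lhs n a y x"
    unfolding ode_lhs_def sum_distrib_left by (intro sum.cong) auto
  then show ?thesis using b(3)[OF J' y x] by simp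
qed

section \<open>Functions of two variables\<close>

definition pd1 :: "(real \<times> real \<Rightarrow> real) \<Rightarrow> real \<times> real \<Rightarrow> real" where
  "pd1 f p = deriv (\<lambda>t. f (t, snd p)) (fst p)"

definition pd2 :: "(real \<times> real \<Rightarrow> real) \<Rightarrow> real \<times> real \<Rightarrow> real" where
  "pd2 f p = deriv (\<lambda>t. f (fst p, t)) (snd p)"

text \<open>Partial derivatives are taken as ordinary derivatives along the coordinate lines, so that
  everything below is one-variable calculus plus this chain rule.\<close>

lemma smooth_on_partial_derivatives:
  fixes f :: "real \<times> real \<Rightarrow> real"
  assumes f: "smooth_on U f" and U: "open U"
  shows smooth_on_pd1: "smooth_on U (pd1 f)" and smooth_on_pd2: "smooth_on U (pd2 f)"
    and chain_rule_plane: "\<And>g h g' h' t. (g has_real_derivative g') (at t) \<Longrightarrow>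
      (h has_real_derivative h') (at t) \<Longrightarrow> (g t, h t) \<in> U \<Longrightarrow>
      ((\<lambda>t. f (g t, h t)) has_real_derivative g' * pd1 f (g t, h t) + h' * pd2 f (g t, h t)) (at t)"
proof -
  obtain f' where f': "\<And>x. x \<in> U \<Longrightarrow> (f has_derivative f' x) (at x)" "\<And>v. smooth_on U (\<lambda>x. f' x v)"
    using smooth_on_has_derivativeE[OF f U] by blast
  have ch: "((\<lambda>t. f (g t, h t)) has_real_derivative g' * f' (g t, h t) (1, 0) + h' * f' (g t, h t) (0, 1)) (at t)"
    if g: "(g has_real_derivative g') (at t)" and h: "(h has_real_derivative h') (at t)"
      and p: "(g t, h t) \<in> U" for g h g' h' t
  proof -
    let ?L = "f' (g t, h t)"
    have "((\<lambda>t. (g t, h t)) has_derivative (\<lambda>v. (g' * v, h' * v))) (at t)"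
      using g h unfolding has_field_derivative_def by (rule has_derivative_Pair)
    from has_derivative_compose[OF this f'(1)[OF p]]
    have d: "((\<lambda>t. f (g t, h t)) has_derivative (\<lambda>v. ?L (g' * v, h' * v))) (at t)" .
    have lin: "linear ?L" using f'(1)[OF p] by (rule has_derivative_linear)
    have "?L (g' * v, h' * v) = (g' * ?L (1, 0) + h' * ?L (0, 1)) * v" for v
    proof -
      have "?L (g' * v, h' * v) = ?L ((g' * v) *\<^sub>R (1, 0) + (h' * v) *\<^sub>R (0, 1))" by simp
      also have "\<dots> = (g' * v) *\<^sub>R ?L (1, 0) + (h' * v) *\<^sub>R ?L (0, 1)"
        by (simp only: linear_add[OF lin] linear_scale[OF lin])
      finally show ?thesis by (simp add: algebra_simps)
    qed
    then have "(\<lambda>v. ?L (g' * v, h' * v)) = (*) (g' * ?L (1, 0) + h' * ?L (0, 1))" by (rule ext)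
    with d show ?thesis unfolding has_field_derivative_def by metis
  qed
  have e1: "f' p (1, 0) = pd1 f p" if "p \<in> U" for p
    using DERIV_imp_deriv[OF ch[OF DERIV_ident DERIV_const[of "snd p"], of "fst p"]] that
    by (simp add: pd1_def)
  have e2: "f' p (0, 1) = pd2 f p" if "p \<in> U" for p
    using DERIV_imp_deriv[OF ch[OF DERIV_const[of "fst p"] DERIV_ident, of "snd p"]] that
    by (simp add: pd2_def)
  show "smooth_on U (pd1 f)" by (rule smooth_on_cong[OF U e1 f'(2)])
  show "smooth_on U (pd2 f)" by (rule smooth_on_cong[OF U e2 f'(2)])
  show "((\<lambda>t. f (g t, h t)) has_real_derivative g' * pd1 f (g t, h t) + h' * pd2 f (g t, h t)) (at t)"
    if "(g has_real_derivative g') (at t)" "(h has_real_derivative h') (at t)" "(g t, h t) \<in> U" for g h g' h' t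
    using ch[OF that] e1[OF that(3)] e2[OF that(3)] by simp
qed

lemma has_real_derivative_pd2:
  assumes "smooth_on U f" "open U" "(x, v) \<in> U"
  shows "((\<lambda>t. f (x, t)) has_real_derivative pd2 f (x, v)) (at v)"
  using chain_rule_plane[OF assms(1,2) DERIV_const DERIV_ident, of x v] assms(3) by simp

lemma pd2_cong:
  assumes "open U" "\<And>p. p \<in> U \<Longrightarrow> f p = g p" "p \<in> U"
  shows "pd2 f p = pd2 g p"
proof -
  have "open ((\<lambda>t. (fst p, t)) -` U)" by (intro open_vimage assms continuous_intros)
  then have "eventually (\<lambda>t. t \<in> (\<lambda>t. (fst p, t)) -` U) (nhds (snd p))"
    using assms(3) by (intro eventually_nhds_in_open) auto
  then have "eventually (\<lambda>t. f (fst p, t) = g (fst p, t)) (nhds (snd p))"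
    by (rule eventually_mono) (simp add: assms(2))
  then show ?thesis unfolding pd2_def by (rule deriv_cong_ev) simp
qed

text \<open>The mean value theorem along vertical segments, whose intermediate point is controlled by
  continuity of the partial derivative. It compares \<open>f\<close> along two curves that meet at \<open>(x1, y1)\<close>.\<close>

lemma divided_difference_tendsto_pd2:
  assumes f: "smooth_on U f" "open U" "(x1, y1) \<in> U"
    and a: "(a \<longlongrightarrow> y1) (at x1)" and b: "(b \<longlongrightarrow> y1) (at x1)"
    and ne: "eventually (\<lambda>x. a x \<noteq> b x) (at x1)"
  shows "((\<lambda>x. (f (x, b x) - f (x, a x)) / (b x - a x)) \<longlongrightarrow> pd2 f (x1, y1)) (at x1)"
proof (rule tendstoI)
  fix e :: real assume e: "e > 0"
  have "continuous_on U (pd2 f)" using smooth_on_pd2[OF f(1,2)] by (rule smooth_on_imp_continuous_on)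
  then have "isCont (pd2 f) (x1, y1)" using f by (simp add: continuous_on_eq_continuous_at)
  then have "eventually (\<lambda>p. dist (pd2 f p) (pd2 f (x1, y1)) < e) (nhds (x1, y1))"
    using e by (auto simp: isCont_def tendsto_iff eventually_nhds_conv_at)
  moreover have "eventually (\<lambda>p. p \<in> U) (nhds (x1, y1))" using f by (intro eventually_nhds_in_open)
  ultimately have "eventually (\<lambda>p. p \<in> U \<and> dist (pd2 f p) (pd2 f (x1, y1)) < e) (nhds (x1, y1))"
    by eventually_elim simp
  then obtain P Q where P: "eventually P (nhds x1)" and Q: "eventually Q (nhds y1)"
    and PQ: "\<And>x v. P x \<Longrightarrow> Q v \<Longrightarrow> (x, v) \<in> U \<and> dist (pd2 f (x, v)) (pd2 f (x1, y1)) < e"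
    unfolding nhds_prod eventually_prod_filter by (auto simp: case_prod_unfold)
  obtain d where d: "d > 0" "\<And>v. dist v y1 < d \<Longrightarrow> Q v" using Q by (auto simp: eventually_nhds_metric)
  have "eventually (\<lambda>x. dist (a x) y1 < d) (at x1)" "eventually (\<lambda>x. dist (b x) y1 < d) (at x1)"
    using a b d(1) by (auto simp: tendsto_iff)
  moreover have "eventually P (at x1)" using P by (simp add: eventually_nhds_conv_at)
  ultimately show "eventually (\<lambda>x. dist ((f (x, b x) - f (x, a x)) / (b x - a x)) (pd2 f (x1, y1)) < e) (at x1)"
    using ne
  proof eventually_elim
    case (elim x)
    have main: "\<exists>v. Q v \<and> f (x, t) - f (x, s) = (t - s) * pd2 f (x, v)"
      if "s < t" "dist s y1 < d" "dist t y1 < d" for s t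
    proof -
      have Qv: "Q v" if "s \<le> v" "v \<le> t" for v
        by (rule d(2)) (use that \<open>dist s y1 < d\<close> \<open>dist t y1 < d\<close> in \<open>auto simp: dist_real_def\<close>)
      have "\<exists>v. s < v \<and> v < t \<and> f (x, t) - f (x, s) = (t - s) * pd2 f (x, v)"
        by (rule MVT2[OF that(1)]) (use PQ Qv elim(3) has_real_derivative_pd2[OF f(1,2)] in auto)
      then show ?thesis using Qv less_imp_le by blast
    qed
    obtain v where v: "Q v" "f (x, b x) - f (x, a x) = (b x - a x) * pd2 f (x, v)"
    proof (cases "a x < b x")
      case True
      then show ?thesis using main[OF True elim(1,2)] that by blast
    next
      case False
      then have "b x < a x" using elim by simp
      from main[OF this elim(2,1)] obtain v where "Q v" "f (x, a x) - f (x, b x) = (a x - b x) * pd2 f (x, v)" by blast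
      then show ?thesis using that[of v] by (simp add: algebra_simps)
    qed
    then show ?case using PQ[OF elim(3) v(1)] elim(4) by simp
  qed
qed

section \<open>Point transformations acting on graphs\<close>

lemma point_transformation_inverse:
  assumes "point_transformation U \<Phi>"
  obtains \<Theta> where "point_transformation (\<Phi> ` U) \<Theta>" "\<And>p. p \<in> U \<Longrightarrow> \<Theta> (\<Phi> p) = p"
proof -
  from assms obtain \<Theta> where T: "smooth_on (\<Phi> ` U) \<Theta>" "\<forall>p\<in>U. \<Theta> (\<Phi> p) = p"
    by (auto simp: point_transformation_def)
  have "\<Theta> ` \<Phi> ` U = U" using T(2) by (force simp: image_iff)
  then have "point_transformation (\<Phi> ` U) \<Theta>"
    using assms T unfolding point_transformation_def by auto
  then show ?thesis using T that by blast
qed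

text \<open>Entries of the product of the Jacobian matrices of \<open>\<Theta>\<close> and \<open>\<Phi>\<close>, obtained by
  differentiating \<open>\<Theta> \<circ> \<Phi> = id\<close> along coordinate lines.\<close>

lemma jacobian_inverse:
  fixes \<Phi> \<Theta> :: "real \<times> real \<Rightarrow> real \<times> real"
  assumes \<Phi>: "open U" "smooth_on U \<Phi>" and \<Theta>: "open (\<Phi> ` U)" "smooth_on (\<Phi> ` U) \<Theta>"
    and inv: "\<And>p. p \<in> U \<Longrightarrow> \<Theta> (\<Phi> p) = p" and p: "p \<in> U"
  defines "Z \<equiv> \<lambda>p. fst (\<Phi> p)" and "W \<equiv> \<lambda>p. snd (\<Phi> p)" and "X \<equiv> \<lambda>q. fst (\<Theta> q)" and "Y \<equiv> \<lambda>q. snd (\<Theta> q)"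
  shows "pd1 Z p * pd1 X (\<Phi> p) + pd1 W p * pd2 X (\<Phi> p) = 1"
    and "pd2 Z p * pd1 X (\<Phi> p) + pd2 W p * pd2 X (\<Phi> p) = 0"
    and "pd2 Z p * pd1 Y (\<Phi> p) + pd2 W p * pd2 Y (\<Phi> p) = 1"
proof -
  obtain x y where xy: "p = (x, y)" by fastforce
  have sm: "smooth_on U Z" "smooth_on U W" "smooth_on (\<Phi> ` U) X" "smooth_on (\<Phi> ` U) Y"
    unfolding Z_def W_def X_def Y_def by (intro smooth_on_fst smooth_on_snd \<Phi> \<Theta>)+
  have ZW: "(Z q, W q) = \<Phi> q" for q by (simp add: Z_def W_def)
  have "open ((\<lambda>t. (t, y)) -` U)" "open ((\<lambda>t. (x, t)) -` U)" by (intro open_vimage \<Phi> continuous_intros)+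
  then have ev: "eventually (\<lambda>t. t \<in> (\<lambda>t. (t, y)) -` U) (nhds x)" "eventually (\<lambda>t. t \<in> (\<lambda>t. (x, t)) -` U) (nhds y)"
    using eventually_nhds_in_open[of "(\<lambda>t. (t, y)) -` U" x] eventually_nhds_in_open[of "(\<lambda>t. (x, t)) -` U" y] p xy
    by simp_all
  have d1: "((\<lambda>t. f (t, y)) has_real_derivative pd1 f p) (at x)" if "smooth_on U f" for f
    using chain_rule_plane[OF that \<Phi>(1) DERIV_ident DERIV_const, of x y] p xy by simp
  have d2: "((\<lambda>t. f (x, t)) has_real_derivative pd2 f p) (at y)" if "smooth_on U f" for f
    using has_real_derivative_pd2[OF that \<Phi>(1)] p xy by simp
  have c1: "((\<lambda>t. f (\<Phi> (t, y))) has_real_derivative pd1 Z p * pd1 f (\<Phi> p) + pd1 W p * pd2 f (\<Phi> p)) (at x)"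
    if "smooth_on (\<Phi> ` U) f" for f
    using chain_rule_plane[OF that \<Theta>(1) d1[OF sm(1)] d1[OF sm(2)]] p xy by (simp add: ZW)
  have c2: "((\<lambda>t. f (\<Phi> (x, t))) has_real_derivative pd2 Z p * pd1 f (\<Phi> p) + pd2 W p * pd2 f (\<Phi> p)) (at y)"
    if "smooth_on (\<Phi> ` U) f" for f
    using chain_rule_plane[OF that \<Theta>(1) d2[OF sm(1)] d2[OF sm(2)]] p xy by (simp add: ZW)
  have "((\<lambda>t. X (\<Phi> (t, y))) has_real_derivative 1) (at x)"
    using DERIV_ident by (rule DERIV_cong_ev[THEN iffD2, rotated 3])
      (use ev(1) in \<open>auto simp: X_def inv elim: eventually_mono\<close>)
  from DERIV_unique[OF c1[OF sm(3)] this]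
  show "pd1 Z p * pd1 X (\<Phi> p) + pd1 W p * pd2 X (\<Phi> p) = 1" .
  have "((\<lambda>t. X (\<Phi> (x, t))) has_real_derivative 0) (at y)"
    using DERIV_const[of x] by (rule DERIV_cong_ev[THEN iffD2, rotated 3])
      (use ev(2) in \<open>auto simp: X_def inv elim: eventually_mono\<close>)
  from DERIV_unique[OF c2[OF sm(3)] this]
  show "pd2 Z p * pd1 X (\<Phi> p) + pd2 W p * pd2 X (\<Phi> p) = 0" .
  have "((\<lambda>t. Y (\<Phi> (x, t))) has_real_derivative 1) (at y)"
    using DERIV_ident by (rule DERIV_cong_ev[THEN iffD2, rotated 3])
      (use ev(2) in \<open>auto simp: Y_def inv elim: eventually_mono\<close>)
  from DERIV_unique[OF c2[OF sm(4)] this]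
  show "pd2 Z p * pd1 Y (\<Phi> p) + pd2 W p * pd2 Y (\<Phi> p) = 1" .
qed

lemma transforms_toD:
  assumes "transforms_to U \<Phi> J y K w" "x \<in> J"
  shows "(x, y x) \<in> U" "fst (\<Phi> (x, y x)) \<in> K" "snd (\<Phi> (x, y x)) = w (fst (\<Phi> (x, y x)))"
proof -
  have "(x, y x) \<in> graph_on J y" using assms(2) by (simp add: graph_on_def)
  with assms(1) show "(x, y x) \<in> U" by (auto simp: transforms_to_def)
  have "\<Phi> (x, y x) \<in> graph_on K w" using assms(1) \<open>(x, y x) \<in> graph_on J y\<close>
    by (auto simp: transforms_to_def)
  then show "fst (\<Phi> (x, y x)) \<in> K" "snd (\<Phi> (x, y x)) = w (fst (\<Phi> (x, y x)))"
    by (auto simp: graph_on_def)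
qed

lemma transforms_to_image:
  assumes "transforms_to U \<Phi> J y K w"
  shows "(\<lambda>x. fst (\<Phi> (x, y x))) ` J = K"
proof -
  have "\<Phi> ` graph_on J y = graph_on K w" using assms by (simp add: transforms_to_def)
  then have "fst ` \<Phi> ` graph_on J y = fst ` graph_on K w" by simp
  then show ?thesis by (simp add: graph_on_def image_image)
qed

text \<open>A curve whose image is nowhere vertical is carried to the graph of a function: its first
  component is a diffeomorphism of intervals, along which the second component is reparametrised.\<close>

lemma push_forward:
  assumes \<Phi>: "smooth_on U \<Phi>" and J: "open_interval J" and y: "smooth_on J y"
    and U: "\<And>x. x \<in> J \<Longrightarrow> (x, y x) \<in> U"
    and D: "\<And>x. x \<in> J \<Longrightarrow> deriv (\<lambda>x. fst (\<Phi> (x, y x))) x \<noteq> 0"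
  obtains K w where "transforms_to U \<Phi> J y K w"
proof -
  define Z where "Z x = fst (\<Phi> (x, y x))" for x
  define W where "W x = snd (\<Phi> (x, y x))" for x
  have sm: "smooth_on J (\<lambda>x. \<Phi> (x, y x))"
    by (rule smooth_on_compose[OF \<Phi> smooth_on_Pair[OF smooth_on_ident y]]) (use U in auto)
  have Z: "smooth_on J Z" unfolding Z_def by (rule smooth_on_fst[OF sm])
  have W: "smooth_on J W" unfolding W_def by (rule smooth_on_snd[OF sm])
  have D': "deriv Z x \<noteq> 0" if "x \<in> J" for x using D[OF that] unfolding Z_def .
  obtain X where X: "open_interval (Z ` J)" "smooth_on (Z ` J) X" "\<And>x. x \<in> J \<Longrightarrow> X (Z x) = x"
    by (rule interval_diffeomorphism[OF J Z]) (erule D', rule that)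
  have "smooth_on (Z ` J) (\<lambda>z. W (X z))"
    by (rule smooth_on_compose[OF W X(2)]) (use X(3) in auto)
  moreover have "\<Phi> ` graph_on J y = graph_on (Z ` J) (\<lambda>z. W (X z))"
    unfolding graph_on_def image_image
    by (rule image_cong) (simp_all add: X(3), simp add: Z_def W_def)
  ultimately have "transforms_to U \<Phi> J y (Z ` J) (\<lambda>z. W (X z))"
    unfolding transforms_to_def using J y U X(1) by (auto simp: graph_on_def)
  then show ?thesis by (rule that)
qed

text \<open>This symmetry turns statements about images of graphs into statements about preimages.\<close>

lemma transforms_to_inverse:
  assumes inv: "\<And>p. p \<in> U \<Longrightarrow> \<Theta> (\<Phi> p) = p"
    and t: "transforms_to (\<Phi> ` U) \<Theta> K w J y"
  shows "transforms_to U \<Phi> J y K w"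
proof -
  have "graph_on K w \<subseteq> \<Phi> ` U" "\<Theta> ` graph_on K w = graph_on J y"
    using t by (auto simp: transforms_to_def)
  note g = this
  have q: "\<Theta> q \<in> U" "\<Phi> (\<Theta> q) = q" if "q \<in> graph_on K w" for q using that g(1) inv by auto
  have "graph_on J y \<subseteq> U" using q(1) unfolding g(2)[symmetric] by blast
  moreover have "\<Phi> ` graph_on J y = graph_on K w"
    unfolding g(2)[symmetric] image_image by (simp add: q(2))
  ultimately show ?thesis using t by (simp add: transforms_to_def)
qed

text \<open>The condition says that the inverse transformation maps the tangent direction \<open>(1, q'(z1))\<close> of the
  graph of \<open>q\<close> to a nonvertical direction; then the pulled back curve is near \<open>x1\<close> the graph of a function.\<close>

lemma pull_back_poly:
  fixes q :: "real poly"
  assumes \<Phi>: "open U" "smooth_on U \<Phi>" and \<Theta>: "open (\<Phi> ` U)" "smooth_on (\<Phi> ` U) \<Theta>"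
    and inv: "\<And>p. p \<in> U \<Longrightarrow> \<Theta> (\<Phi> p) = p"
    and p: "(x1, y1) \<in> U" and q: "\<Phi> (x1, y1) = (z1, poly q z1)"
    and D: "pd1 (\<lambda>q. fst (\<Theta> q)) (\<Phi> (x1, y1)) + poly (pderiv q) z1 * pd2 (\<lambda>q. fst (\<Theta> q)) (\<Phi> (x1, y1)) \<noteq> 0"
  obtains J y K where "transforms_to U \<Phi> J y K (poly q)" "x1 \<in> J" "y x1 = y1"
proof -
  define S where "S = (\<lambda>z. (z, poly q z)) -` (\<Phi> ` U)"
  have S: "open S" unfolding S_def by (intro open_vimage \<Theta> continuous_intros)
  have z1: "z1 \<in> S" using imageI[OF p, of \<Phi>] q unfolding S_def by simp
  define x where "x z = fst (\<Theta> (z, poly q z))" for z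
  have sX: "smooth_on (\<Phi> ` U) (\<lambda>q. fst (\<Theta> q))" by (rule smooth_on_fst[OF \<Theta>(2)])
  have "smooth_on S x" unfolding x_def
    by (rule smooth_on_compose[OF sX smooth_on_Pair[OF smooth_on_ident smooth_on_poly]])
       (auto simp: S_def)
  then have o: "open {z \<in> S. deriv x z \<noteq> 0}"
    by (intro open_nonvanishing_set smooth_on_DERIV(2) S)
  have "deriv x z1 \<noteq> 0"
  proof -
    have "(x has_real_derivative 1 * pd1 (\<lambda>q. fst (\<Theta> q)) (z1, poly q z1) +
        poly (pderiv q) z1 * pd2 (\<lambda>q. fst (\<Theta> q)) (z1, poly q z1)) (at z1)"
      unfolding x_def
      by (rule chain_rule_plane[OF sX \<Theta>(1) DERIV_ident poly_DERIV]) (use z1 in \<open>auto simp: S_def\<close>)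
    then show ?thesis using D q by (simp add: DERIV_imp_deriv)
  qed
  then have "z1 \<in> {z \<in> S. deriv x z \<noteq> 0}" using z1 by simp
  then obtain K where K: "open_interval K" "z1 \<in> K" "K \<subseteq> {z \<in> S. deriv x z \<noteq> 0}"
    by (rule open_intervalE[OF o])
  obtain J y where t: "transforms_to (\<Phi> ` U) \<Theta> K (poly q) J y"
  proof (rule push_forward[OF \<Theta>(2) K(1) smooth_on_poly[of K q]])
    show "(z, poly q z) \<in> \<Phi> ` U" if "z \<in> K" for z using that K(3) by (auto simp: S_def)
    show "deriv (\<lambda>z. fst (\<Theta> (z, poly q z))) z \<noteq> 0" if "z \<in> K" for z
      using that K(3) unfolding x_def by auto
  qed (rule that)
  have "\<Theta> (z1, poly q z1) = (x1, y1)" using inv[OF p] q by simp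
  then have "x1 \<in> J" "y x1 = y1" using transforms_toD[OF t K(2)] by auto
  with transforms_to_inverse[OF inv t] show ?thesis by (intro that)
qed

text \<open>Differentiating \<open>W(x, y(x)) = w(Z(x, y(x)))\<close>. The total derivative of \<open>Z\<close> along the graph cannot vanish: that of
  \<open>W\<close> would vanish with it, and the Jacobian matrix would kill the tangent vector \<open>(1, y')\<close>.\<close>

lemma transversal:
  assumes \<Phi>: "open U" "smooth_on U \<Phi>" and \<Theta>: "open (\<Phi> ` U)" "smooth_on (\<Phi> ` U) \<Theta>"
    and inv: "\<And>p. p \<in> U \<Longrightarrow> \<Theta> (\<Phi> p) = p"
    and t: "transforms_to U \<Phi> J y K w" and x: "x \<in> J"
  defines "Z \<equiv> \<lambda>p. fst (\<Phi> p)" and "W \<equiv> \<lambda>p. snd (\<Phi> p)"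
  shows "((\<lambda>x. Z (x, y x)) has_real_derivative pd1 Z (x, y x) + deriv y x * pd2 Z (x, y x)) (at x)"
    and "pd1 Z (x, y x) + deriv y x * pd2 Z (x, y x) \<noteq> 0"
    and "pd1 W (x, y x) + deriv y x * pd2 W (x, y x) =
      deriv w (Z (x, y x)) * (pd1 Z (x, y x) + deriv y x * pd2 Z (x, y x))"
proof -
  have sm: "smooth_on U Z" "smooth_on U W" unfolding Z_def W_def by (intro smooth_on_fst smooth_on_snd \<Phi>)+
  have J: "open J" "smooth_on J y" and K: "open K" "smooth_on K w"
    using t by (auto simp: transforms_to_def open_interval_def)
  note dy = smooth_on_DERIV(1)[OF J(2,1) x]
  have c: "((\<lambda>x. f (x, y x)) has_real_derivative pd1 f (x, y x) + deriv y x * pd2 f (x, y x)) (at x)"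
    if "smooth_on U f" for f
    using chain_rule_plane[OF that \<Phi>(1) DERIV_ident dy transforms_toD(1)[OF t x]] by simp
  show cZ: "((\<lambda>x. Z (x, y x)) has_real_derivative pd1 Z (x, y x) + deriv y x * pd2 Z (x, y x)) (at x)"
    by (rule c[OF sm(1)])
  have "((\<lambda>x. w (Z (x, y x))) has_real_derivative
      deriv w (Z (x, y x)) * (pd1 Z (x, y x) + deriv y x * pd2 Z (x, y x))) (at x)"
    by (rule DERIV_chain2[OF smooth_on_DERIV(1)[OF K(2,1)] cZ])
       (use transforms_toD(2)[OF t x] in \<open>simp add: Z_def\<close>)
  then have "((\<lambda>x. W (x, y x)) has_real_derivative
      deriv w (Z (x, y x)) * (pd1 Z (x, y x) + deriv y x * pd2 Z (x, y x))) (at x)"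
    by (rule has_field_derivative_transform_within_open[OF _ J(1) x])
       (use transforms_toD(3)[OF t] in \<open>simp add: Z_def W_def\<close>)
  from DERIV_unique[OF c[OF sm(2)] this]
  show W: "pd1 W (x, y x) + deriv y x * pd2 W (x, y x) =
      deriv w (Z (x, y x)) * (pd1 Z (x, y x) + deriv y x * pd2 Z (x, y x))" .
  show "pd1 Z (x, y x) + deriv y x * pd2 Z (x, y x) \<noteq> 0"
  proof
    assume 0: "pd1 Z (x, y x) + deriv y x * pd2 Z (x, y x) = 0"
    let ?X1 = "pd1 (\<lambda>q. fst (\<Theta> q)) (\<Phi> (x, y x))" and ?X2 = "pd2 (\<lambda>q. fst (\<Theta> q)) (\<Phi> (x, y x))"
    note jac = jacobian_inverse[OF \<Phi> \<Theta> inv transforms_toD(1)[OF t x], folded Z_def W_def]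
    have "1 = (pd1 Z (x, y x) + deriv y x * pd2 Z (x, y x)) * ?X1 +
        (pd1 W (x, y x) + deriv y x * pd2 W (x, y x)) * ?X2"
    proof -
      have "(pd1 Z (x, y x) + deriv y x * pd2 Z (x, y x)) * ?X1 +
        (pd1 W (x, y x) + deriv y x * pd2 W (x, y x)) * ?X2 =
        (pd1 Z (x, y x) * ?X1 + pd1 W (x, y x) * ?X2) +
        deriv y x * (pd2 Z (x, y x) * ?X1 + pd2 W (x, y x) * ?X2)" by (simp add: algebra_simps)
      then show ?thesis using jac(1,2) by simp
    qed
    then show False unfolding W 0 by simp
  qed
qed

section \<open>Iterative equations are reducible\<close>

text \<open>Solve \<open>Z' = 1/r\<close> and \<open>E'/E = s/r\<close> near \<open>x0\<close> and transform by \<open>(x, y) \<mapsto> (Z(x), E(x) y)\<close>. By the conjugation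
  identity the \<open>n\<close>-th derivative of the transformed function is a nonvanishing multiple of the
  left-hand side of the equation. Pulling back a constant gives the solution through the point.\<close>

lemma reducible_near_of_iterative_near:
  assumes n: "n \<ge> 1" and "iterative_near I n a x0"
  shows "reducible_near I n a (x0, y0)"
proof -
  from assms(2) obtain J where J: "open_interval J" "x0 \<in> J" "J \<subseteq> I" and "iterative_on J n a"
    by (auto simp: iterative_near_def)
  from this(4) obtain r s c where it: "smooth_on J r \<and> smooth_on J s \<and> smooth_on J c \<and>
        (\<forall>x\<in>J. r x \<noteq> 0) \<and> (\<forall>x\<in>J. c x \<noteq> 0) \<and>
        (\<forall>y. smooth_on J y \<longrightarrow> (\<forall>x\<in>J. (iter_op r s ^^ n) y x = c x * ode_lhs n a y x))"
    unfolding iterative_on_def by (elim exE)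
  then have r: "smooth_on J r" and s: "smooth_on J s"
    and rc: "\<And>x. x \<in> J \<Longrightarrow> r x \<noteq> 0" "\<And>x. x \<in> J \<Longrightarrow> c x \<noteq> 0"
    and eq: "\<And>y x. smooth_on J y \<Longrightarrow> x \<in> J \<Longrightarrow> (iter_op r s ^^ n) y x = c x * ode_lhs n a y x"
    by simp_all
  have oJ: "open J" using J by (simp add: open_interval_def)
  have "smooth_on J (\<lambda>x. inverse (r x))" by (intro smooth_on_inverse r rc)
  then obtain J1 Z where J1: "open_interval J1" "x0 \<in> J1" "J1 \<subseteq> J" and Z: "smooth_on J1 Z"
    "\<And>x. x \<in> J1 \<Longrightarrow> (Z has_real_derivative inverse (r x)) (at x)"
    by (rule smooth_antiderivative_near[OF oJ _ J(2)]) (rule that)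
  have oJ1: "open J1" using J1 by (simp add: open_interval_def)
  have "smooth_on J1 (\<lambda>x. s x / r x)"
    by (intro smooth_on_divide smooth_on_subset[OF r J1(3)] smooth_on_subset[OF s J1(3)]) (use rc J1 in auto)
  then obtain L S where L: "open_interval L" "x0 \<in> L" "L \<subseteq> J1" and S: "smooth_on L S"
    "\<And>x. x \<in> L \<Longrightarrow> (S has_real_derivative s x / r x) (at x)"
    by (rule smooth_antiderivative_near[OF oJ1 _ J1(2)]) (rule that)
  have oL: "open L" using L by (simp add: open_interval_def)
  have LJ: "L \<subseteq> J" using L J1 by blast
  have ZL: "smooth_on L Z" using Z(1) L(3) by (rule smooth_on_subset)
  have dZ: "deriv Z x = inverse (r x)" if "x \<in> L" for x using Z(2) L(3) that by (blast intro: DERIV_imp_deriv)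
  define E where "E x = exp (S x)" for x
  have E: "smooth_on L E" unfolding E_def by (rule smooth_on_exp[OF S(1)])
  have E0: "E x \<noteq> 0" for x by (simp add: E_def)
  have dE: "deriv E x = E x * (s x / r x)" if "x \<in> L" for x
    unfolding E_def by (intro DERIV_imp_deriv DERIV_fun_exp S(2) that)
  have rL: "r x \<noteq> 0" if "x \<in> L" for x using rc(1) LJ that by blast
  obtain X where X: "open_interval (Z ` L)" "smooth_on (Z ` L) X" "\<And>x. x \<in> L \<Longrightarrow> X (Z x) = x"
    by (rule interval_diffeomorphism[OF L(1) ZL]) (simp add: dZ rL, rule that)
  define \<Phi> where "\<Phi> p = (Z (fst p), E (fst p) * snd p)" for p :: "real \<times> real"
  define \<Theta> where "\<Theta> q = (X (fst q), snd q / E (X (fst q)))" for q :: "real \<times> real"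
  define U where "U = L \<times> (UNIV :: real set)"
  have oU: "open U" unfolding U_def using oL by (intro open_Times) auto
  have image: "\<Phi> ` U = (Z ` L) \<times> UNIV"
  proof
    show "(Z ` L) \<times> UNIV \<subseteq> \<Phi> ` U"
    proof
      fix q assume "q \<in> (Z ` L) \<times> (UNIV :: real set)"
      then obtain x w where xw: "x \<in> L" "q = (Z x, w)" by auto
      then have "q = \<Phi> (x, w / E x)" using E0[of x] by (simp add: \<Phi>_def)
      then show "q \<in> \<Phi> ` U" using xw unfolding U_def by blast
    qed
  qed (auto simp: \<Phi>_def U_def)
  have f: "smooth_on T (\<lambda>p :: real \<times> real. fst p)" "smooth_on T (\<lambda>p :: real \<times> real. snd p)" for T
    using smooth_on_fst[OF smooth_on_ident] smooth_on_snd[OF smooth_on_ident] by auto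
  have XL: "X z \<in> L" if "z \<in> Z ` L" for z using that X(3) by auto
  have "smooth_on U \<Phi>" unfolding \<Phi>_def
    by (intro smooth_on_Pair smooth_on_mult f smooth_on_compose[OF ZL f(1)] smooth_on_compose[OF E f(1)])
       (auto simp: U_def)
  moreover have "smooth_on (\<Phi> ` U) \<Theta>"
  proof -
    have XX: "smooth_on (\<Phi> ` U) (\<lambda>p. X (fst p))"
      by (rule smooth_on_compose[OF X(2) f(1)]) (auto simp: image)
    moreover have "smooth_on (\<Phi> ` U) (\<lambda>p. E (X (fst p)))"
      by (rule smooth_on_compose[OF E XX]) (auto simp: image XL)
    ultimately show ?thesis unfolding \<Theta>_def by (intro smooth_on_Pair smooth_on_divide f) (auto simp: E0)
  qed
  moreover have "\<forall>p\<in>U. \<Theta> (\<Phi> p) = p" by (auto simp: U_def \<Phi>_def \<Theta>_def X(3) E0)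
  moreover have "open (\<Phi> ` U)" unfolding image using X(1) by (intro open_Times) (auto simp: open_interval_def)
  ultimately have pt: "point_transformation U \<Phi>"
    unfolding point_transformation_def using oU by blast
  have key: "(deriv ^^ n) w (Z x) = E x * (c x * ode_lhs n a y x)"
    if t: "transforms_to U \<Phi> J' y K w" and x: "x \<in> J'" for J' y K w x
  proof -
    have J': "open J'" "smooth_on J' y" and K: "open K" "smooth_on K w"
      using t by (auto simp: transforms_to_def open_interval_def)
    have L': "J' \<subseteq> L" using transforms_toD(1)[OF t] by (auto simp: U_def)
    have "(deriv ^^ n) w (Z x) = E x * (iter_op r s ^^ n) y x"
    proof (rule funpow_deriv_transport[OF J'(1) K(1) _ _ _ _ _ _ _ K(2) J'(2) _ x])
      show "Z ` J' \<subseteq> K" using transforms_toD(2)[OF t] by (auto simp: \<Phi>_def)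
      show "smooth_on J' Z" "smooth_on J' E" "smooth_on J' r" "smooth_on J' s"
        using L' LJ by (auto intro: smooth_on_subset[OF ZL] smooth_on_subset[OF E]
          smooth_on_subset[OF r] smooth_on_subset[OF s])
      show "w (Z x) = E x * y x" if "x \<in> J'" for x
        using transforms_toD(3)[OF t that] by (simp add: \<Phi>_def)
    qed (use L' in \<open>auto simp: dZ dE rL subset_iff\<close>)
    also have "(iter_op r s ^^ n) y x = c x * ode_lhs n a y x"
      by (rule iterative_on_local[OF oJ r s eq J'(1) _ J'(2) x]) (use L' LJ in auto)
    finally show ?thesis .
  qed
  have iff: "solves n a J' y \<longleftrightarrow> (\<forall>z\<in>K. (deriv ^^ n) w z = 0)"
    if t: "transforms_to U \<Phi> J' y K w" for J' y K w
  proof -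
    have K: "K = Z ` J'" using transforms_to_image[OF t] by (simp add: \<Phi>_def)
    have L': "J' \<subseteq> L" using transforms_toD(1)[OF t] by (auto simp: U_def)
    have "(deriv ^^ n) w (Z x) = 0 \<longleftrightarrow> ode_lhs n a y x = 0" if "x \<in> J'" for x
      using key[OF t that] E0[of x] rc(2)[of x] L' LJ that by auto
    then show ?thesis unfolding solves_def K by auto
  qed
  define C where "C = E x0 * y0"
  have t: "transforms_to U \<Phi> L (\<lambda>x. C / E x) (Z ` L) (poly [:C:])"
    unfolding transforms_to_def graph_on_def image_image
    using L X(1) E E0 by (auto simp: U_def \<Phi>_def intro!: smooth_on_divide smooth_on_const smooth_on_poly)
  have "solves n a L (\<lambda>x. C / E x)"
    unfolding iff[OF t] using n by (auto intro!: funpow_deriv_poly_eq_0)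
  moreover have "(x0, y0) \<in> graph_on L (\<lambda>x. C / E x)"
    using L(2) E0[of x0] by (auto simp: graph_on_def C_def image_iff)
  moreover have "(x0, y0) \<in> U" "U \<subseteq> I \<times> UNIV" using L(2) LJ J(3) by (auto simp: U_def)
  ultimately show ?thesis
    unfolding reducible_near_def using pt iff t
    by (intro exI[of _ U] exI[of _ \<Phi>] conjI exI[of _ L] exI[of _ "\<lambda>x. C / E x"]
        exI[of _ "Z ` L"] exI[of _ "poly [:C:]"] allI impI) simp_all
qed

section \<open>Solutions pulled back from polynomials\<close>

text \<open>Taylor's formula, whose remainder vanishes.\<close>

lemma funpow_deriv_eq_0_imp_poly:
  fixes w :: "real \<Rightarrow> real"
  assumes K: "open_interval K" and w: "smooth_on K w" and n: "n \<ge> 1" and z: "z1 \<in> K"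
    and w0: "\<And>z. z \<in> K \<Longrightarrow> (deriv ^^ n) w z = 0"
  obtains P where "degree P < n" "\<And>z. z \<in> K \<Longrightarrow> w z = poly P z"
proof
  define P where "P = (\<Sum>m<n. smult ((deriv ^^ m) w z1 / fact m) ([:- z1, 1:] ^ m))"
  show "degree P < n" unfolding P_def
  proof (rule degree_sum_less)
    fix m assume "m \<in> {..<n}"
    then have "degree ([:- z1, 1:] ^ m) < n" by (simp add: degree_linear_power)
    then show "degree (smult ((deriv ^^ m) w z1 / fact m) ([:- z1, 1:] ^ m)) < n"
      by (rule le_less_trans[OF degree_smult_le])
  qed (use n in auto)
  have oK: "open K" and iK: "is_interval K" using K by (auto simp: open_interval_def)
  show "w z = poly P z" if zK: "z \<in> K" for z
  proof (cases "z = z1")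
    case True
    have "poly P z1 = (\<Sum>m<n. if m = 0 then w z1 else 0)"
      unfolding P_def poly_sum by (intro sum.cong) (auto simp: poly_power)
    then show ?thesis using n True by simp
  next
    case False
    have sub: "t \<in> K" if "min z z1 \<le> t" "t \<le> max z z1" for t
      using iK z zK that unfolding is_interval_1 by (metis max_def min_def)
    have D: "\<forall>m t. m < n \<and> min z z1 \<le> t \<and> t \<le> max z z1 \<longrightarrow>
        ((deriv ^^ m) w has_real_derivative (deriv ^^ Suc m) w t) (at t)"
      using smooth_on_DERIV(1)[OF smooth_on_funpow_deriv[OF w oK] oK] sub by simp
    have "\<exists>t. (if z < z1 then z < t \<and> t < z1 else z1 < t \<and> t < z) \<and>
        w z = (\<Sum>m<n. ((deriv ^^ m) w z1 / fact m) * (z - z1) ^ m) + ((deriv ^^ n) w t / fact n) * (z - z1) ^ n"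
      by (rule Taylor[OF _ _ D]) (use n False in auto)
    then obtain t where t: "if z < z1 then z < t \<and> t < z1 else z1 < t \<and> t < z"
      "w z = (\<Sum>m<n. ((deriv ^^ m) w z1 / fact m) * (z - z1) ^ m) + ((deriv ^^ n) w t / fact n) * (z - z1) ^ n"
      by blast
    have "t \<in> K" by (rule sub) (use t(1) in \<open>auto split: if_splits\<close>)
    with t(2) w0 have "w z = (\<Sum>m<n. ((deriv ^^ m) w z1 / fact m) * (z - z1) ^ m)" by simp
    also have "\<dots> = poly P z" unfolding P_def poly_sum by (simp add: poly_power)
    finally show ?thesis .
  qed
qed

text \<open>A polynomial of degree at most \<open>N\<close> that is asymptotic to \<open>t (z - z1)\<^sup>N\<close> along points accumulating at \<open>z1\<close>, in
  the sense of the limit below, has no lower order terms at \<open>z1\<close>.\<close>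

lemma poly_eq_of_leading_behaviour:
  fixes P :: "real poly"
  assumes deg: "degree P \<le> N" and \<zeta>: "(\<zeta> \<longlongrightarrow> z1) F" "eventually (\<lambda>x. \<zeta> x \<noteq> z1) F" and F: "F \<noteq> bot"
    and lim: "((\<lambda>x. poly P (\<zeta> x) / (\<zeta> x - z1) ^ N) \<longlongrightarrow> t) F"
  shows "P = smult t ([:- z1, 1:] ^ N)"
proof (rule ccontr)
  assume ne: "P \<noteq> smult t ([:- z1, 1:] ^ N)"
  define R where "R = P - smult t ([:- z1, 1:] ^ N)"
  have "R \<noteq> 0" using ne by (simp add: R_def)
  have "degree R \<le> N" unfolding R_def
    by (rule degree_diff_le[OF deg]) (simp add: degree_linear_power le_trans[OF degree_smult_le])
  obtain Q where Q: "R = [:- z1, 1:] ^ order z1 R * Q" "\<not> [:- z1, 1:] dvd Q"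
    using order_decomp[OF \<open>R \<noteq> 0\<close>, of z1] by auto
  define k where "k = order z1 R"
  have k: "k \<le> N" using order_degree[OF \<open>R \<noteq> 0\<close>, of z1] \<open>degree R \<le> N\<close> by (simp add: k_def)
  have "((\<lambda>x. (poly P (\<zeta> x) / (\<zeta> x - z1) ^ N - t) * (\<zeta> x - z1) ^ (N - k)) \<longlongrightarrow> (t - t) * (z1 - z1) ^ (N - k)) F"
    by (intro tendsto_intros lim \<zeta>)
  moreover have "eventually (\<lambda>x. (poly P (\<zeta> x) / (\<zeta> x - z1) ^ N - t) * (\<zeta> x - z1) ^ (N - k) = poly Q (\<zeta> x)) F"
    using \<zeta>(2)
  proof eventually_elim
    case (elim x)
    have "poly P (\<zeta> x) - t * (\<zeta> x - z1) ^ N = poly R (\<zeta> x)" by (simp add: R_def poly_power)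
    also have "\<dots> = (\<zeta> x - z1) ^ k * poly Q (\<zeta> x)" by (subst Q(1)) (simp add: poly_power k_def)
    finally have "poly P (\<zeta> x) = t * (\<zeta> x - z1) ^ N + (\<zeta> x - z1) ^ k * poly Q (\<zeta> x)" by simp
    moreover have "(\<zeta> x - z1) ^ N = (\<zeta> x - z1) ^ k * (\<zeta> x - z1) ^ (N - k)"
      using k by (simp flip: power_add)
    ultimately show ?case using elim by (simp add: field_simps)
  qed
  ultimately have "((\<lambda>x. poly Q (\<zeta> x)) \<longlongrightarrow> 0) F"
    using tendsto_cong by fastforce
  moreover have "((\<lambda>x. poly Q (\<zeta> x)) \<longlongrightarrow> poly Q z1) F" by (intro tendsto_poly \<zeta>)
  ultimately have "poly Q z1 = 0" using tendsto_unique[OF F] by blast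
  with Q(2) show False by (simp add: poly_eq_0_iff_dvd)
qed

text \<open>The data provided by a reducible equation: a point transformation \<open>\<Phi> = (Z, W)\<close> with inverse \<open>\<Theta>\<close>, whose
  first component is called \<open>X\<close> below. Among the functions that are transformed into functions, the solutions are
  those that become polynomials of degree less than \<open>n\<close>.\<close>

locale reduction =
  fixes I :: "real set" and n :: nat and a :: "nat \<Rightarrow> real \<Rightarrow> real"
    and U :: "(real \<times> real) set" and \<Phi> \<Theta> :: "real \<times> real \<Rightarrow> real \<times> real"
  assumes ode: "linear_ode I n a"
    and U: "open U" "U \<subseteq> I \<times> UNIV"
    and \<Phi>: "smooth_on U \<Phi>"
    and \<Theta>: "open (\<Phi> ` U)" "smooth_on (\<Phi> ` U) \<Theta>"
    and inv: "\<And>p. p \<in> U \<Longrightarrow> \<Theta> (\<Phi> p) = p"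
    and red: "\<And>J y K w. transforms_to U \<Phi> J y K w \<Longrightarrow>
      solves n a J y \<longleftrightarrow> (\<forall>z\<in>K. (deriv ^^ n) w z = 0)"
begin

definition "Z = (\<lambda>p. fst (\<Phi> p))"
definition "W = (\<lambda>p. snd (\<Phi> p))"
definition "X = (\<lambda>q. fst (\<Theta> q))"

lemma \<Phi>_eq: "\<Phi> p = (Z p, W p)"
  by (simp add: Z_def W_def)

lemma fst_\<Phi>: "fst (\<Phi> p) = Z p" and snd_\<Phi>: "snd (\<Phi> p) = W p"
  by (simp_all add: Z_def W_def)

lemma smooth_Z: "smooth_on U Z" and smooth_W: "smooth_on U W"
  unfolding Z_def W_def by (intro smooth_on_fst smooth_on_snd \<Phi>)+

lemmas jacobian = jacobian_inverse[OF U(1) \<Phi> \<Theta> inv, folded Z_def W_def X_def]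

text \<open>At most one direction \<open>(1, m)\<close> at \<open>\<Phi> p\<close> is the image of the vertical direction at \<open>p\<close>. Two good slopes are
  kept because for order two they give two independent solutions.\<close>

lemma nonvertical_slopes:
  assumes "p \<in> U"
  obtains m1 m2 where "m1 \<noteq> m2" "pd1 X (\<Phi> p) + m1 * pd2 X (\<Phi> p) \<noteq> 0" "pd1 X (\<Phi> p) + m2 * pd2 X (\<Phi> p) \<noteq> 0"
proof (cases "pd2 X (\<Phi> p) = 0")
  case True
  then have "pd1 X (\<Phi> p) \<noteq> 0" using jacobian(1)[OF _ assms] by auto
  then show ?thesis using that[of 0 1] True by simp
next
  case False
  then show ?thesis using that[of "1 - pd1 X (\<Phi> p) / pd2 X (\<Phi> p)" "2 - pd1 X (\<Phi> p) / pd2 X (\<Phi> p)"]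
    by (simp add: field_simps)
qed

text \<open>The source of all solutions below: a polynomial of degree less than \<open>n\<close> solves the canonical equation, so its
  pullback solves the given one.\<close>

lemma pull_back:
  assumes p: "(x1, y1) \<in> U" and q: "poly q (Z (x1, y1)) = W (x1, y1)" "degree q < n"
    and D: "pd1 X (\<Phi> (x1, y1)) + poly (pderiv q) (Z (x1, y1)) * pd2 X (\<Phi> (x1, y1)) \<noteq> 0"
  obtains J y K where "transforms_to U \<Phi> J y K (poly q)" "x1 \<in> J" "y x1 = y1"
    "open_interval J" "smooth_on J y" "solves n a J y"
proof -
  have "\<Phi> (x1, y1) = (Z (x1, y1), poly q (Z (x1, y1)))" using q by (simp add: \<Phi>_eq)
  from pull_back_poly[OF U(1) \<Phi> \<Theta> inv p this D[unfolded X_def]]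
  obtain J y K where t: "transforms_to U \<Phi> J y K (poly q)" "x1 \<in> J" "y x1 = y1" .
  have "solves n a J y" unfolding red[OF t(1)] using q(2) by (simp add: funpow_deriv_poly_eq_0)
  then show ?thesis using t by (intro that[of J y K]) (auto simp: transforms_to_def)
qed

lemma transforms_to_Z_W:
  assumes "transforms_to U \<Phi> J y K w" "x \<in> J"
  shows "(x, y x) \<in> U" "Z (x, y x) \<in> K" "W (x, y x) = w (Z (x, y x))" "x \<in> I"
  using transforms_toD[OF assms] U(2) by (auto simp: Z_def W_def)

lemmas transversal_Z_W = transversal[OF U(1) \<Phi> \<Theta> inv, folded Z_def W_def,
  unfolded fst_\<Phi> snd_\<Phi>]

section \<open>Reducible equations of order two\<close>

text \<open>For order two \<open>\<Phi>\<close> need not preserve the vertical fibres (projective maps permute straight lines), but it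
  suffices to pull back two lines through one point. The solutions \<open>f\<close>, \<open>g\<close> have a common value \<open>y1\<close> at \<open>x0\<close> and
  different slopes; choosing \<open>y1 \<noteq> 0\<close> makes \<open>f\<close> and \<open>((g - f) / f) f\<close> a fundamental system of the required form.\<close>

lemma iterative_near_of_order_2:
  assumes n: "n = 2" and p: "(x0, y0) \<in> U"
  shows "iterative_near I n a x0"
proof -
  \<comment> \<open>The base point may be moved vertically, since only \<open>x0\<close> matters in the conclusion.\<close>
  obtain y1 where y1: "y1 \<noteq> 0" "(x0, y1) \<in> U"
  proof -
    have "open ((\<lambda>t. (x0, t)) -` U)" by (intro open_vimage U continuous_intros)
    then obtain e where e: "e > 0" "ball y0 e \<subseteq> (\<lambda>t. (x0, t)) -` U"
      using p open_contains_ball_eq by (metis vimageI)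
    then have "y0 + e / 2 \<in> (\<lambda>t. (x0, t)) -` U" by (auto simp: dist_real_def subset_iff)
    then have "(x0, y0 + e / 2) \<in> U" by simp
    then show ?thesis using that[of y0] that[of "y0 + e / 2"] p e(1) by (cases "y0 = 0") auto
  qed
  let ?z = "Z (x0, y1)" and ?w = "W (x0, y1)"
  obtain m1 m2 where m: "m1 \<noteq> m2" "pd1 X (\<Phi> (x0, y1)) + m1 * pd2 X (\<Phi> (x0, y1)) \<noteq> 0"
    "pd1 X (\<Phi> (x0, y1)) + m2 * pd2 X (\<Phi> (x0, y1)) \<noteq> 0"
    by (rule nonvertical_slopes[OF y1(2)])
  define q where "q m = [:?w - m * ?z, m:]" for m
  have q: "poly (q m) ?z = ?w" "degree (q m) < n" "poly (pderiv (q m)) z = m" for m z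
    using n by (simp_all add: q_def pderiv_pCons)
  have dq: "deriv (poly (q m)) z = m" for m z
    using q(3) by (metis DERIV_imp_deriv poly_DERIV)
  obtain Ja f Ka where f: "transforms_to U \<Phi> Ja f Ka (poly (q m1))" "x0 \<in> Ja" "f x0 = y1"
    "open_interval Ja" "smooth_on Ja f" "solves n a Ja f"
    by (rule pull_back[OF y1(2) q(1,2)[of m1]]) (use m(2) q(3) in auto)
  obtain Jb g Kb where g: "transforms_to U \<Phi> Jb g Kb (poly (q m2))" "x0 \<in> Jb" "g x0 = y1"
    "open_interval Jb" "smooth_on Jb g" "solves n a Jb g"
    by (rule pull_back[OF y1(2) q(1,2)[of m2]]) (use m(3) q(3) in auto)
  have "deriv f x0 \<noteq> deriv g x0"
  proof
    \<comment> \<open>Equal tangents at \<open>x0\<close> would have images of equal slope, but these slopes are \<open>m1\<close> and \<open>m2\<close>.\<close>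
    assume eq: "deriv f x0 = deriv g x0"
    let ?D = "pd1 Z (x0, y1) + deriv f x0 * pd2 Z (x0, y1)"
    have "?D \<noteq> 0" using transversal_Z_W(2)[OF _ f(1,2)] f(3) by simp
    moreover have "m1 * ?D = m2 * ?D"
      using transversal_Z_W(3)[OF _ f(1,2)] transversal_Z_W(3)[OF _ g(1,2)] f(3) g(3) eq dq by simp
    ultimately show False using m(1) by simp
  qed
  define A where "A = Ja \<inter> Jb"
  have A: "open A" "x0 \<in> A" using f(2,4) g(2,4) by (auto simp: A_def open_interval_def)
  have sf: "smooth_on A f" "solves n a A f" and sg: "smooth_on A g" "solves n a A g"
    unfolding A_def by (rule smooth_on_subset[OF f(5)] solves_subset[OF f(6)]
      smooth_on_subset[OF g(5)] solves_subset[OF g(6)]; blast)+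
  define B where "B = {x \<in> A. f x \<noteq> 0}"
  have B: "open B" "x0 \<in> B" "B \<subseteq> A" using open_nonvanishing_set[OF A(1) sf(1)] A(2) f(3) y1(1) by (auto simp: B_def)
  have f0: "f x \<noteq> 0" if "x \<in> B" for x using that by (simp add: B_def)
  define Q where "Q x = (g x - f x) / f x" for x
  have Q: "smooth_on B Q" unfolding Q_def
    by (intro smooth_on_divide smooth_on_diff smooth_on_subset[OF sf(1) B(3)] smooth_on_subset[OF sg(1) B(3)])
       (use f0 in auto)
  have "deriv Q x0 \<noteq> 0"
  proof -
    have "(Q has_real_derivative ((deriv g x0 - deriv f x0) * f x0 - (g x0 - f x0) * deriv f x0) / (f x0 * f x0)) (at x0)"
      unfolding Q_def by (intro DERIV_divide DERIV_diff smooth_on_DERIV(1)[OF sf(1) A]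
        smooth_on_DERIV(1)[OF sg(1) A] f0 B)
    then have "deriv Q x0 = (deriv g x0 - deriv f x0) / y1"
      using f(3) g(3) y1(1) by (simp add: DERIV_imp_deriv)
    then show ?thesis using \<open>deriv f x0 \<noteq> deriv g x0\<close> y1(1) by simp
  qed
  then have "x0 \<in> {x \<in> B. deriv Q x \<noteq> 0}" using B by simp
  then obtain J where J: "open_interval J" "x0 \<in> J" "J \<subseteq> {x \<in> B. deriv Q x \<noteq> 0}"
    by (rule open_intervalE[OF open_nonvanishing_set[OF B(1) smooth_on_DERIV(2)[OF Q B(1)]]])
  have oJ: "open J" using J(1) by (simp add: open_interval_def)
  have JA: "J \<subseteq> A" "J \<subseteq> B" using J(3) B(3) by auto
  have JI: "J \<subseteq> I" using JA(1) transforms_to_Z_W(4)[OF f(1)] by (auto simp: A_def)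
  have "iterative_on J n a"
  proof (rule iterative_on_of_fundamental_system[OF ode J(1) JI])
    show "smooth_on J Q" by (rule smooth_on_subset[OF Q JA(2)])
    show "deriv Q x \<noteq> 0" if "x \<in> J" for x using that J(3) by auto
    show "smooth_on J f" by (rule smooth_on_subset[OF sf(1) JA(1)])
    show "f x \<noteq> 0" if "x \<in> J" for x using that JA(2) f0 by auto
    show "solves n a J (\<lambda>x. Q x ^ k * f x)" if k: "k < n" for k
    proof -
      consider "k = 0" | "k = 1" using k n by linarith
      then show ?thesis
      proof cases
        case 1
        then show ?thesis using solves_subset[OF sf(2) JA(1)] by simp
      next
        case 2
        have "solves n a J (\<lambda>x. g x - f x)"
          by (intro solves_subset[OF solves_diff[OF A(1) sg(1) sf(1) sg(2) sf(2)] JA(1)])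
        then show ?thesis
          by (rule solves_cong[OF oJ, rotated]) (use JA(2) f0 2 in \<open>auto simp: Q_def\<close>)
      qed
    qed
  qed
  then show ?thesis unfolding iterative_near_def using J(1,2) JI by blast
qed

section \<open>Rigidity of the transformation in order at least three\<close>

text \<open>The heart of the case \<open>n \<ge> 3\<close>. Through \<open>\<Phi>(x1, y1)\<close> take a line \<open>q0\<close> and the polynomial
  \<open>q1(z) = q0(z) + (z - z1)\<^sup>n\<^sup>-\<^sup>1\<close>, and let \<open>y\<close> and \<open>v\<close> be the solutions obtained by pulling them back. Their difference \<open>u = v - y\<close>
  vanishes at \<open>x1\<close> to order exactly \<open>n - 1 \<ge> 2\<close>. By linearity all \<open>y + t u\<close> are solutions, so they
  are carried to polynomials of degree less than \<open>n\<close>; since these agree with \<open>q0\<close> up to order \<open>n - 2\<close> at \<open>z1\<close>, they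
  are of the form \<open>q0(z) + \<tau> (z - z1)\<^sup>n\<^sup>-\<^sup>1\<close>, and comparing leading terms at \<open>x1\<close> gives \<open>\<tau> = t\<close>. Thus the linear structures
  on the two sides match along this family, which is a strong constraint on \<open>\<Phi>\<close>. Here \<open>c\<close> and \<open>m\<close> are the
  coefficients of \<open>q0\<close>.\<close>

lemma family_identity:
  assumes n: "n \<ge> 3" and p: "(x1, y1) \<in> U"
  obtains c m y u J e where "open_interval J" "x1 \<in> J" "smooth_on J y" "smooth_on J u" "y x1 = y1" "e > 0"
    "\<And>x t. x \<in> J \<Longrightarrow> \<bar>t\<bar> < e \<Longrightarrow> (x, y x + t * u x) \<in> U"
    "\<And>x t. x \<in> J \<Longrightarrow> \<bar>t\<bar> < e \<Longrightarrow> W (x, y x + t * u x) - m * Z (x, y x + t * u x) - c =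
      t * (Z (x, y x + t * u x) - Z (x1, y1)) ^ (n - 1)"
    "eventually (\<lambda>x. u x \<noteq> 0) (at x1)" "eventually (\<lambda>x. Z (x, y x) \<noteq> Z (x1, y1)) (at x1)"
    "pd2 W (x1, y1) - m * pd2 Z (x1, y1) \<noteq> 0"
proof -
  define N where "N = n - 1"
  have N: "N \<ge> 2" "N < n" using n by (auto simp: N_def)
  let ?z = "Z (x1, y1)" and ?w = "W (x1, y1)"
  obtain m where m: "pd1 X (\<Phi> (x1, y1)) + m * pd2 X (\<Phi> (x1, y1)) \<noteq> 0"
    by (rule nonvertical_slopes[OF p])
  define c where "c = ?w - m * ?z"
  define q0 where "q0 = [:c, m:]"
  define q1 where "q1 = q0 + [:- ?z, 1:] ^ N"
  have q0: "poly q0 ?z = ?w" "degree q0 < n" "poly (pderiv q0) ?z = m"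
    using n by (simp_all add: q0_def c_def pderiv_pCons)
  have "poly (pderiv ([:- ?z, 1:] ^ N)) ?z = 0"
    using N(1) by (simp add: pderiv_power poly_power)
  then have q1: "poly q1 ?z = ?w" "degree q1 < n" "poly (pderiv q1) ?z = m"
    using q0 N by (auto simp: q1_def pderiv_add poly_power degree_linear_power intro!: degree_add_less)
  obtain Ja y Ka where y: "transforms_to U \<Phi> Ja y Ka (poly q0)" "x1 \<in> Ja" "y x1 = y1"
    "open_interval Ja" "smooth_on Ja y" "solves n a Ja y"
    by (rule pull_back[OF p q0(1,2)]) (use m q0(3) in auto)
  obtain Jb v Kb where v: "transforms_to U \<Phi> Jb v Kb (poly q1)" "x1 \<in> Jb" "v x1 = y1"
    "open_interval Jb" "smooth_on Jb v" "solves n a Jb v"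
    by (rule pull_back[OF p q1(1,2)]) (use m q1(3) in auto)
  define L where "L = Ja \<inter> Jb"
  have L: "open L" "x1 \<in> L" using y(2,4) v(2,4) by (auto simp: L_def open_interval_def)
  have sy: "smooth_on L y" "solves n a L y" and sv: "smooth_on L v" "solves n a L v"
    unfolding L_def by (rule smooth_on_subset[OF y(5)] solves_subset[OF y(6)]
      smooth_on_subset[OF v(5)] solves_subset[OF v(6)]; blast)+
  define u where "u x = v x - y x" for x
  have su: "smooth_on L u" "solves n a L u" unfolding u_def
    by (intro smooth_on_diff sy sv, intro solves_diff L sy sv)
  have u1: "u x1 = 0" by (simp add: u_def y(3) v(3))
  \<comment> \<open>\<open>V\<close> straightens the target: the line \<open>q0\<close> becomes the zero set of \<open>V\<close>.\<close>
  define V where "V p = W p - m * Z p - c" for p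
  have sV: "smooth_on U V" unfolding V_def
    by (intro smooth_on_diff smooth_on_mult smooth_on_const smooth_Z smooth_W)
  have pd2V: "pd2 V (x1, y1) = pd2 W (x1, y1) - m * pd2 Z (x1, y1)"
  proof -
    have "((\<lambda>t. V (x1, t)) has_real_derivative pd2 W (x1, y1) - m * pd2 Z (x1, y1) - 0) (at y1)"
      unfolding V_def by (intro DERIV_diff DERIV_cmult DERIV_const
        has_real_derivative_pd2[OF smooth_W U(1) p] has_real_derivative_pd2[OF smooth_Z U(1) p])
    from DERIV_imp_deriv[OF this] show ?thesis by (simp add: pd2_def)
  qed
  have Vy: "pd2 V (x1, y1) \<noteq> 0"
  proof
    assume "pd2 V (x1, y1) = 0"
    then have e: "pd2 W (x1, y1) = m * pd2 Z (x1, y1)" using pd2V by simp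
    have "pd2 Z (x1, y1) * (pd1 X (\<Phi> (x1, y1)) + m * pd2 X (\<Phi> (x1, y1))) = 0"
      using jacobian(2)[OF _ p] e by (simp add: algebra_simps)
    then have "pd2 Z (x1, y1) = 0" using m by simp
    then show False using e jacobian(3)[OF _ p] by simp
  qed
  have V0: "V (x, y x) = 0" if "x \<in> L" for x
    using transforms_to_Z_W(3)[OF y(1), of x] that by (simp add: V_def q0_def L_def)
  have V1: "V (x, v x) = (Z (x, v x) - ?z) ^ N" if "x \<in> L" for x
    using transforms_to_Z_W(3)[OF v(1), of x] that by (simp add: V_def q0_def q1_def L_def poly_power)
  have evL: "eventually (\<lambda>x. x \<in> L) (at x1)" using L by (rule eventually_at_in_open')
  have ev1: "eventually (\<lambda>x. x \<noteq> x1) (at x1)" by (simp add: eventually_at_filter)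
  have cont: "(f \<longlongrightarrow> f x1) (at x1)" if "smooth_on L f" for f :: "real \<Rightarrow> real"
    using DERIV_isCont[OF smooth_on_DERIV(1)[OF that L]] by (simp add: isCont_def)
  define Dv where "Dv = pd1 Z (x1, y1) + deriv v x1 * pd2 Z (x1, y1)"
  define D where "D = pd1 Z (x1, y1) + deriv y x1 * pd2 Z (x1, y1)"
  have Dv: "((\<lambda>x. (Z (x, v x) - ?z) / (x - x1)) \<longlongrightarrow> Dv) (at x1)" "Dv \<noteq> 0"
    using transversal_Z_W(1,2)[OF _ v(1,2)] v(3) by (simp_all add: has_field_derivative_iff Dv_def)
  have D: "((\<lambda>x. (Z (x, y x) - ?z) / (x - x1)) \<longlongrightarrow> D) (at x1)" "D \<noteq> 0"
    using transversal_Z_W(1,2)[OF _ y(1,2)] y(3) by (simp_all add: has_field_derivative_iff D_def)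
  have evv: "eventually (\<lambda>x. Z (x, v x) \<noteq> ?z) (at x1)"
    using tendsto_imp_eventually_ne[OF Dv] by eventually_elim auto
  have evy: "eventually (\<lambda>x. Z (x, y x) \<noteq> ?z) (at x1)"
    using tendsto_imp_eventually_ne[OF D] by eventually_elim auto
  have evu: "eventually (\<lambda>x. u x \<noteq> 0) (at x1)"
    using evv evL
  proof eventually_elim
    case (elim x)
    then show ?case using V0[of x] V1[of x] by (auto simp: u_def)
  qed
  \<comment> \<open>Since \<open>V\<close> is zero on the graph of \<open>y\<close> and \<open>(Z - z1)\<^sup>N\<close> on that of \<open>v\<close>, its vertical divided difference
      determines the order of vanishing of \<open>u = v - y\<close>.\<close>
  have "((\<lambda>x. (V (x, v x) - V (x, y x)) / (v x - y x)) \<longlongrightarrow> pd2 V (x1, y1)) (at x1)"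
  proof (rule divided_difference_tendsto_pd2[OF sV U(1) p])
    show "(y \<longlongrightarrow> y1) (at x1)" "(v \<longlongrightarrow> y1) (at x1)"
      using cont[OF sy(1)] cont[OF sv(1)] y(3) v(3) by simp_all
    show "eventually (\<lambda>x. y x \<noteq> v x) (at x1)" using evu by eventually_elim (simp add: u_def)
  qed
  then have "((\<lambda>x. ((Z (x, v x) - ?z) / (x - x1)) ^ N / ((V (x, v x) - V (x, y x)) / (v x - y x))) \<longlongrightarrow>
      Dv ^ N / pd2 V (x1, y1)) (at x1)"
    by (intro tendsto_intros Dv Vy)
  moreover have "eventually (\<lambda>x. ((Z (x, v x) - ?z) / (x - x1)) ^ N / ((V (x, v x) - V (x, y x)) / (v x - y x)) =
      u x / (x - x1) ^ N) (at x1)"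
    using evv evL evu ev1
    by eventually_elim (simp add: V0 V1 u_def[symmetric] power_divide)
  ultimately have lim_u: "((\<lambda>x. u x / (x - x1) ^ N) \<longlongrightarrow> Dv ^ N / pd2 V (x1, y1)) (at x1)"
    by (rule Lim_transform_eventually)
  \<comment> \<open>As \<open>N \<ge> 2\<close>, \<open>u\<close> vanishes to second order, so all curves \<open>y + t u\<close> share the tangent at \<open>x1\<close>.\<close>
  have "((\<lambda>x. u x / (x - x1) ^ N * (x - x1) ^ (N - 1)) \<longlongrightarrow> Dv ^ N / pd2 V (x1, y1) * (x1 - x1) ^ (N - 1)) (at x1)"
    by (intro tendsto_intros lim_u)
  moreover have "eventually (\<lambda>x. u x / (x - x1) ^ N * (x - x1) ^ (N - 1) = (u x - u x1) / (x - x1)) (at x1)"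
    using ev1
  proof eventually_elim
    case (elim x)
    have "(x - x1) ^ N = (x - x1) ^ (N - 1) * (x - x1)" using N(1) by (simp flip: power_Suc2)
    then show ?case using elim u1 by simp
  qed
  ultimately have "((\<lambda>x. (u x - u x1) / (x - x1)) \<longlongrightarrow> Dv ^ N / pd2 V (x1, y1) * (x1 - x1) ^ (N - 1)) (at x1)"
    by (rule Lim_transform_eventually)
  then have "((\<lambda>x. (u x - u x1) / (x - x1)) \<longlongrightarrow> 0) (at x1)"
    using N(1) by (simp add: power_0_left)
  then have "(u has_real_derivative 0) (at x1)" by (simp add: has_field_derivative_iff)
  then have du: "deriv u x1 = 0" by (rule DERIV_imp_deriv)
  moreover have "deriv u x1 = deriv v x1 - deriv y x1" unfolding u_def
    by (intro DERIV_imp_deriv DERIV_diff smooth_on_DERIV(1)[OF sy(1) L] smooth_on_DERIV(1)[OF sv(1) L])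
  ultimately have DD: "Dv = D" by (simp add: D_def Dv_def)

  \<comment> \<open>A single interval \<open>J\<close> must serve all small \<open>t\<close>: the graph of \<open>y + t u\<close> over \<open>J\<close> has to stay in \<open>U\<close>
      and its image must not become vertical. Both are open conditions on \<open>(x, t)\<close> that hold at \<open>(x1, 0)\<close>;
      \<open>H\<close> is the total derivative of \<open>Z\<close> along the graph.\<close>
  define curve where "curve p = (fst p, y (fst p) + snd p * u (fst p))" for p :: "real \<times> real"
  define H where "H p = pd1 Z (curve p) + (deriv y (fst p) + snd p * deriv u (fst p)) * pd2 Z (curve p)" for p
  define S where "S = (L \<times> UNIV) \<inter> curve -` U"
  have f: "smooth_on T (\<lambda>p :: real \<times> real. fst p)" "smooth_on T (\<lambda>p :: real \<times> real. snd p)" for T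
    using smooth_on_fst[OF smooth_on_ident] smooth_on_snd[OF smooth_on_ident] by auto
  have fL: "smooth_on (L \<times> (UNIV :: real set)) (\<lambda>p. g (fst p))" if "smooth_on L g" for g :: "real \<Rightarrow> real"
    by (rule smooth_on_compose[OF that f(1)]) auto
  have oL: "open (L \<times> (UNIV :: real set))" using L(1) by (intro open_Times) auto
  have sc: "smooth_on (L \<times> UNIV) curve" unfolding curve_def
    by (intro smooth_on_Pair smooth_on_add smooth_on_mult fL sy su f)
  have oS: "open S" unfolding S_def
    by (rule continuous_open_preimage[OF smooth_on_imp_continuous_on[OF sc] oL U(1)])
  have scS: "smooth_on S curve" by (rule smooth_on_subset[OF sc]) (auto simp: S_def)
  have cS: "curve ` S \<subseteq> U" by (auto simp: S_def)
  have "smooth_on S H"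
  proof -
    have "smooth_on S (\<lambda>p. deriv y (fst p))" "smooth_on S (\<lambda>p. deriv u (fst p))"
      by (rule smooth_on_subset[OF fL[OF smooth_on_DERIV(2)]], use sy su L in \<open>auto simp: S_def\<close>)+
    then show ?thesis unfolding H_def
      by (intro smooth_on_add smooth_on_mult f smooth_on_compose[OF smooth_on_pd1[OF smooth_Z U(1)] scS cS]
        smooth_on_compose[OF smooth_on_pd2[OF smooth_Z U(1)] scS cS])
  qed
  then have "open {q \<in> S. H q \<noteq> 0}" by (rule open_nonvanishing_set[OF oS])
  moreover have "(x1, 0) \<in> {q \<in> S. H q \<noteq> 0}"
    using L(2) p y(3) D(2) by (simp add: S_def curve_def H_def D_def)
  ultimately obtain A B where AB: "open A" "open B" "x1 \<in> A" "0 \<in> B" "A \<times> B \<subseteq> {q \<in> S. H q \<noteq> 0}"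
    by (auto elim!: open_prod_elim)
  obtain J where J: "open_interval J" "x1 \<in> J" "J \<subseteq> A" by (rule open_intervalE[OF AB(1,3)])
  obtain e where e: "e > 0" "ball 0 e \<subseteq> B" using AB(2,4) open_contains_ball by blast
  have box: "x \<in> L" "(x, y x + t * u x) \<in> U" "H (x, t) \<noteq> 0" if "x \<in> J" "\<bar>t\<bar> < e" for x t
  proof -
    have "t \<in> ball 0 e" using that(2) by (simp add: dist_real_def)
    then have "(x, t) \<in> A \<times> B" using J(3) e(2) that(1) by blast
    then have "(x, t) \<in> {q \<in> S. H q \<noteq> 0}" using AB(5) by blast
    then show "x \<in> L" "(x, y x + t * u x) \<in> U" "H (x, t) \<noteq> 0" by (auto simp: S_def curve_def)
  qed
  have oJ: "open J" using J(1) by (simp add: open_interval_def)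
  have JL: "J \<subseteq> L" using box(1)[of _ 0] e(1) by auto
  have syJ: "smooth_on J y" and suJ: "smooth_on J u" and solJ: "solves n a J y" "solves n a J u"
    by (rule smooth_on_subset[OF sy(1) JL] smooth_on_subset[OF su(1) JL]
      solves_subset[OF sy(2) JL] solves_subset[OF su(2) JL])+
  have ident: "V (x, y x + t * u x) = t * (Z (x, y x + t * u x) - ?z) ^ N"
    if x: "x \<in> J" and t: "\<bar>t\<bar> < e" for x t
  proof (cases "t = 0")
    case True
    then show ?thesis using V0[of x] x JL by auto
  next
    case False
    define yt where "yt x = y x + t * u x" for x
    have st: "smooth_on J yt" unfolding yt_def by (intro smooth_on_add smooth_on_mult smooth_on_const syJ suJ)
    have solt: "solves n a J yt" unfolding yt_def
      by (intro solves_add solves_cmult oJ syJ suJ solJ smooth_on_mult smooth_on_const)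
    have ytU: "(x, yt x) \<in> U" if "x \<in> J" for x using box(2)[OF that t] by (simp add: yt_def)
    have dZ: "((\<lambda>x. Z (x, yt x)) has_real_derivative H (x, t)) (at x)" if xJ: "x \<in> J" for x
    proof -
      have "(yt has_real_derivative deriv y x + t * deriv u x) (at x)"
        unfolding yt_def by (intro DERIV_add DERIV_cmult smooth_on_DERIV(1)[OF syJ oJ xJ] smooth_on_DERIV(1)[OF suJ oJ xJ])
      from chain_rule_plane[OF smooth_Z U(1) DERIV_ident this ytU[OF xJ]]
      show ?thesis by (simp add: H_def curve_def yt_def)
    qed
    obtain K w where w: "transforms_to U \<Phi> J yt K w"
    proof (rule push_forward[OF \<Phi> J(1) st ytU])
      show "deriv (\<lambda>x. fst (\<Phi> (x, yt x))) x \<noteq> 0" if "x \<in> J" for x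
        using DERIV_imp_deriv[OF dZ[OF that]] box(3)[OF that t] by (simp add: Z_def)
    qed auto
    have K: "open_interval K" "smooth_on K w" using w by (auto simp: transforms_to_def)
    have w0: "(deriv ^^ n) w z = 0" if "z \<in> K" for z using red[OF w] solt that by blast
    obtain P where P: "degree P < n" "\<And>z. z \<in> K \<Longrightarrow> w z = poly P z"
      by (rule funpow_deriv_eq_0_imp_poly[OF K _ transforms_to_Z_W(2)[OF w J(2)] w0])
         (use n in auto)
    have VP: "V (x, yt x) = poly (P - q0) (Z (x, yt x))" if "x \<in> J" for x
      using transforms_to_Z_W(2,3)[OF w that] P(2) by (simp add: V_def q0_def)
    have yt1: "yt x1 = y1" by (simp add: yt_def y(3) u1)
    have H1: "H (x1, t) = D" by (simp add: H_def curve_def D_def y(3) u1 du)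
    have Zt: "((\<lambda>x. (Z (x, yt x) - ?z) / (x - x1)) \<longlongrightarrow> D) (at x1)"
      using dZ[OF J(2)] yt1 H1 by (simp add: has_field_derivative_iff)
    have evt: "eventually (\<lambda>x. Z (x, yt x) \<noteq> ?z) (at x1)"
      using tendsto_imp_eventually_ne[OF Zt D(2)] by eventually_elim auto
    have ct: "(yt \<longlongrightarrow> y1) (at x1)"
      using DERIV_isCont[OF smooth_on_DERIV(1)[OF st oJ J(2)]] yt1 by (simp add: isCont_def)
    \<comment> \<open>Near \<open>x1\<close>, \<open>V\<close> along the curve is comparable to \<open>t u\<close> times \<open>V\<^sub>y\<close>, and the order of \<open>u\<close> is known; the
        constants \<open>V\<^sub>y\<close> and \<open>D\<^sup>N\<close> cancel and leave exactly \<open>t\<close>.\<close>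
    have "((\<lambda>x. (V (x, yt x) - V (x, y x)) / (yt x - y x)) \<longlongrightarrow> pd2 V (x1, y1)) (at x1)"
    proof (rule divided_difference_tendsto_pd2[OF sV U(1) p _ ct])
      show "(y \<longlongrightarrow> y1) (at x1)" using cont[OF sy(1)] y(3) by simp
      show "eventually (\<lambda>x. y x \<noteq> yt x) (at x1)" using evu by eventually_elim (simp add: yt_def False)
    qed
    then have "((\<lambda>x. (V (x, yt x) - V (x, y x)) / (yt x - y x) * t * (u x / (x - x1) ^ N) /
        ((Z (x, yt x) - ?z) / (x - x1)) ^ N) \<longlongrightarrow> pd2 V (x1, y1) * t * (Dv ^ N / pd2 V (x1, y1)) / D ^ N) (at x1)"
      by (rule tendsto_divide[OF tendsto_mult[OF tendsto_mult[OF _ tendsto_const] lim_u] tendsto_power[OF Zt]])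
         (use D(2) in simp)
    moreover have "eventually (\<lambda>x. (V (x, yt x) - V (x, y x)) / (yt x - y x) * t * (u x / (x - x1) ^ N) /
        ((Z (x, yt x) - ?z) / (x - x1)) ^ N = poly (P - q0) (Z (x, yt x)) / (Z (x, yt x) - ?z) ^ N) (at x1)"
      using evu evt ev1 eventually_at_in_open'[OF oJ J(2)]
    proof eventually_elim
      case (elim x)
      have "V (x, y x) = 0" using elim JL V0 by auto
      moreover have "yt x - y x = t * u x" by (simp add: yt_def)
      moreover have "V (x, yt x) = poly (P - q0) (Z (x, yt x))" by (rule VP[OF elim(4)])
      ultimately show ?case using elim False by (simp add: power_divide)
    qed
    ultimately have "((\<lambda>x. poly (P - q0) (Z (x, yt x)) / (Z (x, yt x) - ?z) ^ N) \<longlongrightarrow>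
        pd2 V (x1, y1) * t * (Dv ^ N / pd2 V (x1, y1)) / D ^ N) (at x1)"
      by (rule Lim_transform_eventually)
    moreover have "pd2 V (x1, y1) * t * (Dv ^ N / pd2 V (x1, y1)) / D ^ N = t"
      using Vy D(2) DD by simp
    ultimately have lim: "((\<lambda>x. poly (P - q0) (Z (x, yt x)) / (Z (x, yt x) - ?z) ^ N) \<longlongrightarrow> t) (at x1)"
      by simp
    have "P - q0 = smult t ([:- ?z, 1:] ^ N)"
    proof (rule poly_eq_of_leading_behaviour[OF _ _ evt _ lim])
      have "degree P \<le> N" "degree q0 \<le> N" using P(1) q0(2) by (auto simp: N_def)
      then show "degree (P - q0) \<le> N" by (rule degree_diff_le)
      show "((\<lambda>x. Z (x, yt x)) \<longlongrightarrow> ?z) (at x1)"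
        using DERIV_isCont[OF dZ[OF J(2)]] yt1 by (simp add: isCont_def)
    qed simp
    then have "poly (P - q0) (Z (x, yt x)) = t * (Z (x, yt x) - ?z) ^ N"
      by (simp only: poly_smult poly_power) simp
    then show ?thesis using VP[OF x] by (simp add: yt_def)
  qed
  show ?thesis
  proof (rule that[OF J(1,2) syJ suJ y(3) e(1)])
    show "W (x, y x + t * u x) - m * Z (x, y x + t * u x) - c =
      t * (Z (x, y x + t * u x) - Z (x1, y1)) ^ (n - 1)" if "x \<in> J" "\<bar>t\<bar> < e" for x t
      using ident[OF that] unfolding V_def N_def .
    show "pd2 W (x1, y1) - m * pd2 Z (x1, y1) \<noteq> 0" using Vy pd2V by simp
  qed (use box evu evy in auto)
qed

text \<open>Differentiating the preceding identity at \<open>t = 0\<close>, once and twice, at a fixed \<open>x \<noteq> x1\<close>. With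
  \<open>V = W - m Z - c\<close>, \<open>N = n - 1\<close>, \<open>g\<^sub>0 = Z - z1\<close>, and subscripts for vertical derivatives this reads \<open>u V\<^sub>y = g\<^sub>0\<^sup>N\<close> and
  \<open>u\<^sup>2 V\<^sub>y\<^sub>y = 2 N g\<^sub>0\<^sup>N\<^sup>-\<^sup>1 u Z\<^sub>y\<close>; eliminating the power of \<open>g\<^sub>0\<close> leaves \<open>V\<^sub>y\<^sub>y g\<^sub>0 = 2 N V\<^sub>y Z\<^sub>y\<close>, in which \<open>u\<close> no
  longer occurs.\<close>

lemma second_order_identity:
  assumes n: "n \<ge> 3" and p: "(x1, y1) \<in> U"
  obtains m y where "(y \<longlongrightarrow> y1) (at x1)" "eventually (\<lambda>x. (x, y x) \<in> U) (at x1)"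
    "eventually (\<lambda>x. Z (x, y x) \<noteq> Z (x1, y1)) (at x1)"
    "eventually (\<lambda>x. (pd2 (pd2 W) (x, y x) - m * pd2 (pd2 Z) (x, y x)) * (Z (x, y x) - Z (x1, y1)) =
       2 * real (n - 1) * (pd2 W (x, y x) - m * pd2 Z (x, y x)) * pd2 Z (x, y x)) (at x1)"
    "pd2 W (x1, y1) - m * pd2 Z (x1, y1) \<noteq> 0"
proof -
  obtain c m y u J e where J: "open_interval J" "x1 \<in> J" and y: "smooth_on J y" and u: "smooth_on J u"
    and y1: "y x1 = y1" and e: "e > 0"
    and inU: "\<And>x t. x \<in> J \<Longrightarrow> \<bar>t\<bar> < e \<Longrightarrow> (x, y x + t * u x) \<in> U"
    and fam: "\<And>x t. x \<in> J \<Longrightarrow> \<bar>t\<bar> < e \<Longrightarrow> W (x, y x + t * u x) - m * Z (x, y x + t * u x) - c =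
      t * (Z (x, y x + t * u x) - Z (x1, y1)) ^ (n - 1)"
    and ev: "eventually (\<lambda>x. u x \<noteq> 0) (at x1)" "eventually (\<lambda>x. Z (x, y x) \<noteq> Z (x1, y1)) (at x1)"
    and Vy: "pd2 W (x1, y1) - m * pd2 Z (x1, y1) \<noteq> 0"
    by (rule family_identity[OF n p]) (rule that)
  define N where "N = n - 1"
  have N: "N \<ge> 2" using n by (simp add: N_def)
  have oJ: "open J" using J(1) by (simp add: open_interval_def)
  have evJ: "eventually (\<lambda>x. x \<in> J) (at x1)" using oJ J(2) by (rule eventually_at_in_open')
  have id: "(pd2 (pd2 W) (x, y x) - m * pd2 (pd2 Z) (x, y x)) * (Z (x, y x) - Z (x1, y1)) =
       2 * real N * (pd2 W (x, y x) - m * pd2 Z (x, y x)) * pd2 Z (x, y x)"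
    if x: "x \<in> J" and u0: "u x \<noteq> 0" for x
  proof -
    define q where "q t = (x, y x + t * u x)" for t
    define g where "g t = Z (q t) - Z (x1, y1)" for t
    have d: "((\<lambda>t. f (q t)) has_real_derivative u x * pd2 f (q t)) (at t)"
      if f: "smooth_on U f" and t: "\<bar>t\<bar> < e" for f t
    proof -
      have "((\<lambda>t. y x + t * u x) has_real_derivative u x) (at t)"
        by (auto intro!: derivative_eq_intros)
      from chain_rule_plane[OF f U(1) DERIV_const[of x] this inU[OF x t]]
      show ?thesis by (simp add: q_def)
    qed
    have dg: "(g has_real_derivative u x * pd2 Z (q t)) (at t)" if t: "\<bar>t\<bar> < e" for t
      using DERIV_diff[OF d[OF smooth_Z t] DERIV_const[of "Z (x1, y1)"]] unfolding g_def by simp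
    have dgN: "((\<lambda>t. g t ^ N) has_real_derivative real N * (u x * pd2 Z (q t) * g t ^ (N - 1))) (at t)"
      if t: "\<bar>t\<bar> < e" for t
      using DERIV_power[OF dg[OF t], of N] by (simp add: mult_ac)
    have first: "u x * (pd2 W (q t) - m * pd2 Z (q t)) =
      g t ^ N + t * (real N * (u x * pd2 Z (q t) * g t ^ (N - 1)))" if t: "\<bar>t\<bar> < e" for t
    proof (rule DERIV_unique)
      have "((\<lambda>t. W (q t) - m * Z (q t) - c) has_real_derivative
          u x * pd2 W (q t) - m * (u x * pd2 Z (q t)) - 0) (at t)"
        by (intro DERIV_diff DERIV_cmult DERIV_const d smooth_W smooth_Z t)
      then show "((\<lambda>t. W (q t) - m * Z (q t) - c) has_real_derivative
          u x * (pd2 W (q t) - m * pd2 Z (q t))) (at t)" by (simp add: algebra_simps)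
      have "((\<lambda>t. t * g t ^ N) has_real_derivative
        1 * g t ^ N + real N * (u x * pd2 Z (q t) * g t ^ (N - 1)) * t) (at t)"
        by (rule DERIV_mult[OF DERIV_ident dgN[OF t]])
      then have "((\<lambda>t. t * g t ^ N) has_real_derivative
        g t ^ N + t * (real N * (u x * pd2 Z (q t) * g t ^ (N - 1)))) (at t)"
        by (simp add: mult_ac)
      moreover have "t \<in> ball 0 e" using t by (simp add: dist_real_def)
      ultimately show "((\<lambda>t. W (q t) - m * Z (q t) - c) has_real_derivative
        g t ^ N + t * (real N * (u x * pd2 Z (q t) * g t ^ (N - 1)))) (at t)"
        by (rule has_field_derivative_transform_within_open[OF _ open_ball])
           (simp add: q_def g_def N_def fam[OF x] dist_real_def)
    qed
    have e0: "\<bar>0 :: real\<bar> < e" using e by simp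
    have s2: "smooth_on U (pd2 W)" "smooth_on U (pd2 Z)"
      by (intro smooth_on_pd2 smooth_W smooth_Z U)+
    have "u x * (u x * pd2 (pd2 W) (q 0) - m * (u x * pd2 (pd2 Z) (q 0))) =
        2 * (real N * (u x * pd2 Z (q 0) * g 0 ^ (N - 1)))"
    proof (rule DERIV_unique)
      show A: "((\<lambda>t. u x * (pd2 W (q t) - m * pd2 Z (q t))) has_real_derivative
          u x * (u x * pd2 (pd2 W) (q 0) - m * (u x * pd2 (pd2 Z) (q 0)))) (at 0)"
        by (intro DERIV_diff DERIV_cmult d s2 e0)
      \<comment> \<open>The second summand has the factor \<open>t\<close>, so its derivative at \<open>0\<close> is the value of the
          cofactor \<open>k\<close> there, whatever the derivative \<open>k'\<close>.\<close>
      define k where "k t = real N * (u x * pd2 Z (q t) * g t ^ (N - 1))" for t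
      obtain k' where k': "(k has_real_derivative k') (at 0)"
      proof -
        have "((\<lambda>t. u x * pd2 Z (q t) * g t ^ (N - 1)) has_real_derivative
           (u x * (u x * pd2 (pd2 Z) (q 0))) * g 0 ^ (N - 1) +
           (real (N - 1) * (u x * pd2 Z (q 0) * g 0 ^ (N - 1 - 1))) * (u x * pd2 Z (q 0))) (at 0)"
          using DERIV_mult[OF DERIV_cmult[OF d[OF s2(2) e0]] DERIV_power[OF dg[OF e0], of "N - 1"]]
          by (simp add: mult_ac)
        from that[unfolded k_def, OF DERIV_cmult[OF this]] show ?thesis .
      qed
      have "((\<lambda>t. g t ^ N + t * k t) has_real_derivative
          real N * (u x * pd2 Z (q 0) * g 0 ^ (N - 1)) + (1 * k 0 + k' * 0)) (at 0)"
        by (intro DERIV_add dgN e0 DERIV_mult DERIV_ident k')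
      then have "((\<lambda>t. g t ^ N + t * k t) has_real_derivative
          2 * (real N * (u x * pd2 Z (q 0) * g 0 ^ (N - 1)))) (at 0)"
        by (simp add: k_def mult.assoc)
      moreover have "(0 :: real) \<in> ball 0 e" using e by simp
      ultimately show "((\<lambda>t. u x * (pd2 W (q t) - m * pd2 Z (q t))) has_real_derivative
          2 * (real N * (u x * pd2 Z (q 0) * g 0 ^ (N - 1)))) (at 0)"
        by (rule has_field_derivative_transform_within_open[OF _ open_ball])
           (simp add: first k_def dist_real_def)
    qed
    moreover have "u x * (pd2 W (q 0) - m * pd2 Z (q 0)) = g 0 ^ N" using first[OF e0] by simp
    moreover have "g 0 ^ N = g 0 ^ (N - 1) * g 0" using N by (simp flip: power_Suc2)
    moreover have "(v * v) * ((A - m * B) * g0) = (v * v) * (2 * M * C * D)"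
      if "v * (v * A - m * (v * B)) = 2 * (M * (v * D * G))" "v * C = H" "H = G * g0"
      for v A B m g0 M C D G H :: real using that by algebra
    ultimately have "(u x * u x) * ((pd2 (pd2 W) (q 0) - m * pd2 (pd2 Z) (q 0)) * g 0) =
       (u x * u x) * (2 * real N * (pd2 W (q 0) - m * pd2 Z (q 0)) * pd2 Z (q 0))" by blast
    then show ?thesis using u0 by (simp add: q_def g_def)
  qed
  show ?thesis
  proof (rule that)
    show "(y \<longlongrightarrow> y1) (at x1)"
      using DERIV_isCont[OF smooth_on_DERIV(1)[OF y oJ J(2)]] y1 by (simp add: isCont_def)
    show "eventually (\<lambda>x. (x, y x) \<in> U) (at x1)"
      using evJ by eventually_elim (use inU[of _ 0] e in simp)
    show "eventually (\<lambda>x. (pd2 (pd2 W) (x, y x) - m * pd2 (pd2 Z) (x, y x)) * (Z (x, y x) - Z (x1, y1)) =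
       2 * real (n - 1) * (pd2 W (x, y x) - m * pd2 Z (x, y x)) * pd2 Z (x, y x)) (at x1)"
      using evJ ev(1) by eventually_elim (use id in \<open>simp add: N_def\<close>)
  qed (fact ev(2) Vy)+
qed

lemma smooth_tendsto_along_curve:
  assumes f: "smooth_on U f" and p: "(x1, y1) \<in> U" and y: "(y \<longlongrightarrow> y1) (at x1)"
  shows "((\<lambda>x. f (x, y x)) \<longlongrightarrow> f (x1, y1)) (at x1)"
proof -
  have "isCont f (x1, y1)"
    using smooth_on_imp_continuous_on[OF f] p U(1) by (simp add: continuous_on_eq_continuous_at)
  moreover have "((\<lambda>x. (x, y x)) \<longlongrightarrow> (x1, y1)) (at x1)" by (intro tendsto_intros y)
  ultimately show ?thesis by (rule isCont_tendsto_compose)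
qed

text \<open>In the identity \<open>V\<^sub>y\<^sub>y (Z - z1) = 2 (n - 1) V\<^sub>y Z\<^sub>y\<close> let \<open>x \<rightarrow> x1\<close>: the left-hand side tends to zero and \<open>V\<^sub>y\<close> does not,
  so \<open>Z\<^sub>y\<close> vanishes at the arbitrary point \<open>p\<close>. Hence \<open>\<Phi>\<close> preserves the vertical fibres.\<close>

lemma pd2_Z_eq_0:
  assumes n: "n \<ge> 3" and p: "p \<in> U"
  shows "pd2 Z p = 0"
proof -
  obtain x1 y1 where xy: "p = (x1, y1)" by fastforce
  have p': "(x1, y1) \<in> U" using p xy by simp
  obtain m y where y: "(y \<longlongrightarrow> y1) (at x1)"
    and id: "eventually (\<lambda>x. (pd2 (pd2 W) (x, y x) - m * pd2 (pd2 Z) (x, y x)) * (Z (x, y x) - Z (x1, y1)) =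
       2 * real (n - 1) * (pd2 W (x, y x) - m * pd2 Z (x, y x)) * pd2 Z (x, y x)) (at x1)"
    and Vy: "pd2 W (x1, y1) - m * pd2 Z (x1, y1) \<noteq> 0"
    by (rule second_order_identity[OF n p'])
  note lim = smooth_tendsto_along_curve[OF _ p' y]
  have s: "smooth_on U (pd2 W)" "smooth_on U (pd2 Z)" by (intro smooth_on_pd2 smooth_W smooth_Z U)+
  have s2: "smooth_on U (pd2 (pd2 W))" "smooth_on U (pd2 (pd2 Z))" by (intro smooth_on_pd2 s U)+
  have "((\<lambda>x. (pd2 (pd2 W) (x, y x) - m * pd2 (pd2 Z) (x, y x)) * (Z (x, y x) - Z (x1, y1))) \<longlongrightarrow>
     (pd2 (pd2 W) (x1, y1) - m * pd2 (pd2 Z) (x1, y1)) * (Z (x1, y1) - Z (x1, y1))) (at x1)"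
    by (intro tendsto_intros lim s2 smooth_Z)
  then have "((\<lambda>x. 2 * real (n - 1) * (pd2 W (x, y x) - m * pd2 Z (x, y x)) * pd2 Z (x, y x)) \<longlongrightarrow>
     (pd2 (pd2 W) (x1, y1) - m * pd2 (pd2 Z) (x1, y1)) * (Z (x1, y1) - Z (x1, y1))) (at x1)"
    using id by (rule Lim_transform_eventually)
  moreover have "((\<lambda>x. 2 * real (n - 1) * (pd2 W (x, y x) - m * pd2 Z (x, y x)) * pd2 Z (x, y x)) \<longlongrightarrow>
     2 * real (n - 1) * (pd2 W (x1, y1) - m * pd2 Z (x1, y1)) * pd2 Z (x1, y1)) (at x1)"
    by (intro tendsto_intros lim s)
  ultimately have "(pd2 (pd2 W) (x1, y1) - m * pd2 (pd2 Z) (x1, y1)) * (Z (x1, y1) - Z (x1, y1)) =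
     2 * real (n - 1) * (pd2 W (x1, y1) - m * pd2 Z (x1, y1)) * pd2 Z (x1, y1)"
    by (rule LIM_unique)
  then show ?thesis using Vy n xy by simp
qed

text \<open>Now that \<open>Z\<^sub>y = 0\<close> throughout \<open>U\<close>, the same identity says \<open>W\<^sub>y\<^sub>y = 0\<close> at points of the curve with \<open>Z \<noteq> z1\<close>, and these
  accumulate at \<open>p\<close>. Hence \<open>\<Phi>\<close> is affine on the fibres.\<close>

lemma pd2_pd2_W_eq_0:
  assumes n: "n \<ge> 3" and p: "p \<in> U"
  shows "pd2 (pd2 W) p = 0"
proof -
  obtain x1 y1 where xy: "p = (x1, y1)" by fastforce
  have p': "(x1, y1) \<in> U" using p xy by simp
  obtain m y where y: "(y \<longlongrightarrow> y1) (at x1)" "eventually (\<lambda>x. (x, y x) \<in> U) (at x1)"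
    "eventually (\<lambda>x. Z (x, y x) \<noteq> Z (x1, y1)) (at x1)"
    and id: "eventually (\<lambda>x. (pd2 (pd2 W) (x, y x) - m * pd2 (pd2 Z) (x, y x)) * (Z (x, y x) - Z (x1, y1)) =
       2 * real (n - 1) * (pd2 W (x, y x) - m * pd2 Z (x, y x)) * pd2 Z (x, y x)) (at x1)"
    by (rule second_order_identity[OF n p'])
  have Z2: "pd2 (pd2 Z) q = 0" if "q \<in> U" for q
  proof -
    have "pd2 (pd2 Z) q = pd2 (\<lambda>_. 0) q" by (rule pd2_cong[OF U(1) _ that]) (rule pd2_Z_eq_0[OF n])
    then show ?thesis by (simp add: pd2_def)
  qed
  have "eventually (\<lambda>x. pd2 (pd2 W) (x, y x) = 0) (at x1)"
    using y(2,3) id by eventually_elim (simp add: Z2 pd2_Z_eq_0[OF n])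
  moreover have "((\<lambda>x. pd2 (pd2 W) (x, y x)) \<longlongrightarrow> pd2 (pd2 W) (x1, y1)) (at x1)"
    by (intro smooth_tendsto_along_curve smooth_on_pd2 smooth_W U p' y)
  ultimately have "((\<lambda>x. 0 :: real) \<longlongrightarrow> pd2 (pd2 W) (x1, y1)) (at x1)"
    by (rule Lim_transform_eventually[rotated])
  then have "pd2 (pd2 W) (x1, y1) = 0" by (rule LIM_unique[OF _ tendsto_const])
  then show ?thesis using xy by simp
qed

section \<open>Reducible equations are iterative\<close>

text \<open>On a box around the point, \<open>\<Phi>(x, v) = (\<zeta>(x), \<gamma>(x) v + h(x))\<close>. Pulling back the functions \<open>w1 + \<epsilon> z\<^sup>k\<close> gives the solutions
  \<open>f + \<epsilon> \<zeta>\<^sup>k / \<gamma>\<close> with \<open>f = (w1 - h) / \<gamma>\<close>, and subtracting the one for \<open>\<epsilon> = 0\<close> leaves the fundamental system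
  \<open>\<zeta>\<^sup>k / \<gamma>\<close>. The small factor \<open>\<epsilon>\<close> only keeps the graphs inside the box.\<close>

lemma iterative_near_of_order_ge_3:
  assumes n: "n \<ge> 3" and p: "(x0, y0) \<in> U"
  shows "iterative_near I n a x0"
proof -
  obtain A C where AC: "open A" "open C" "x0 \<in> A" "y0 \<in> C" "A \<times> C \<subseteq> U"
    using U(1) p by (auto elim!: open_prod_elim)
  obtain e where e: "e > 0" "ball y0 e \<subseteq> C" using AC(2,4) open_contains_ball by blast
  have box: "(x, v) \<in> U" if "x \<in> A" "v \<in> ball y0 e" for x v using AC(5) e(2) that by blast
  have y0: "y0 \<in> ball y0 e" using e(1) by simp
  have const: "f v = f y0" if "\<And>v. v \<in> ball y0 e \<Longrightarrow> (f has_real_derivative 0) (at v)" "v \<in> ball y0 e" for f v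
  proof -
    have "\<exists>c. \<forall>v\<in>ball y0 e. f v = c"
      by (rule has_field_derivative_zero_constant)
         (use that(1) in \<open>auto intro: has_field_derivative_at_within\<close>)
    then show ?thesis using that(2) y0 by auto
  qed
  define \<zeta> where "\<zeta> x = Z (x, y0)" for x
  define \<gamma> where "\<gamma> x = pd2 W (x, y0)" for x
  define h where "h x = W (x, y0) - \<gamma> x * y0" for x
  have Z: "Z (x, v) = \<zeta> x" if x: "x \<in> A" and v: "v \<in> ball y0 e" for x v
    unfolding \<zeta>_def
    by (rule const[OF _ v]) (use has_real_derivative_pd2[OF smooth_Z U(1) box[OF x]] pd2_Z_eq_0[OF n box[OF x]] in simp)
  have sW2: "smooth_on U (pd2 W)" by (intro smooth_on_pd2 smooth_W U)
  have W2: "pd2 W (x, v) = \<gamma> x" if x: "x \<in> A" and v: "v \<in> ball y0 e" for x v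
    unfolding \<gamma>_def
    by (rule const[OF _ v]) (use has_real_derivative_pd2[OF sW2 U(1) box[OF x]] pd2_pd2_W_eq_0[OF n box[OF x]] in simp)
  have W: "W (x, v) = \<gamma> x * v + h x" if x: "x \<in> A" and v: "v \<in> ball y0 e" for x v
  proof -
    have "W (x, v) - \<gamma> x * v = W (x, y0) - \<gamma> x * y0"
    proof (rule const[OF _ v])
      fix v assume v: "v \<in> ball y0 e"
      have "((\<lambda>v. W (x, v) - \<gamma> x * v) has_real_derivative pd2 W (x, v) - \<gamma> x * 1) (at v)"
        by (intro DERIV_diff DERIV_cmult DERIV_ident has_real_derivative_pd2[OF smooth_W U(1) box[OF x v]])
      then show "((\<lambda>v. W (x, v) - \<gamma> x * v) has_real_derivative 0) (at v)" using W2[OF x v] by simp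
    qed
    then show ?thesis by (simp add: h_def)
  qed
  have sl: "smooth_on A (\<lambda>x. f (x, y0))" if "smooth_on U f" for f :: "real \<times> real \<Rightarrow> real"
    by (rule smooth_on_compose[OF that smooth_on_Pair[OF smooth_on_ident smooth_on_const]])
       (use box y0 in auto)
  have s: "smooth_on A \<zeta>" "smooth_on A \<gamma>" "smooth_on A h" unfolding \<zeta>_def \<gamma>_def h_def
    by (intro smooth_on_diff smooth_on_mult smooth_on_const sl smooth_Z sW2 smooth_W)+
  have nondeg: "\<gamma> x \<noteq> 0" "deriv \<zeta> x \<noteq> 0" if x: "x \<in> A" for x
  proof -
    note U' = box[OF x y0]
    have W2: "\<gamma> x \<noteq> 0" using jacobian(3)[OF _ U'] pd2_Z_eq_0[OF n U'] by (auto simp: \<gamma>_def)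
    have "pd2 X (\<Phi> (x, y0)) = 0"
      using jacobian(2)[OF _ U'] pd2_Z_eq_0[OF n U'] W2 by (simp add: \<gamma>_def)
    then have Z1: "pd1 Z (x, y0) \<noteq> 0" using jacobian(1)[OF _ U'] by auto
    have "(\<zeta> has_real_derivative 1 * pd1 Z (x, y0) + 0 * pd2 Z (x, y0)) (at x)"
      unfolding \<zeta>_def by (rule chain_rule_plane[OF smooth_Z U(1) DERIV_ident DERIV_const U'])
    then show "\<gamma> x \<noteq> 0" "deriv \<zeta> x \<noteq> 0" using Z1 W2 by (simp_all add: DERIV_imp_deriv)
  qed
  define w1 where "w1 = W (x0, y0)"
  define f where "f x = (w1 - h x) / \<gamma> x" for x
  define \<phi> where "\<phi> k x = \<zeta> x ^ k * inverse (\<gamma> x)" for k x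
  have sf: "smooth_on A f" unfolding f_def
    by (intro smooth_on_divide smooth_on_diff smooth_on_const s nondeg)
  have s\<phi>: "smooth_on A (\<phi> k)" for k unfolding \<phi>_def
    by (intro smooth_on_mult smooth_on_power smooth_on_inverse s nondeg)
  have f0: "f x0 = y0" using nondeg(1)[OF AC(3)] by (simp add: f_def w1_def h_def)
  define M where "M k = \<bar>\<phi> k x0\<bar> + 1" for k
  have cont: "(g \<longlongrightarrow> g x0) (nhds x0)" if "smooth_on A g" for g :: "real \<Rightarrow> real"
    using DERIV_isCont[OF smooth_on_DERIV(1)[OF that AC(1,3)]] by (simp add: isCont_def tendsto_nhds_iff)
  have "eventually (\<lambda>x. dist (f x) (f x0) < e / 2) (nhds x0)"
    by (rule tendstoD[OF cont[OF sf]]) (use e(1) in simp)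
  moreover have "eventually (\<lambda>x. \<forall>k\<in>{..<n}. \<bar>\<phi> k x\<bar> < M k) (nhds x0)"
  proof (rule eventually_ball_finite)
    show "\<forall>k\<in>{..<n}. eventually (\<lambda>x. \<bar>\<phi> k x\<bar> < M k) (nhds x0)"
    proof
      fix k
      have "((\<lambda>x. \<bar>\<phi> k x\<bar>) \<longlongrightarrow> \<bar>\<phi> k x0\<bar>) (nhds x0)" by (intro tendsto_rabs cont s\<phi>)
      then show "eventually (\<lambda>x. \<bar>\<phi> k x\<bar> < M k) (nhds x0)"
        by (rule order_tendstoD(2)) (simp add: M_def)
    qed
  qed simp
  ultimately have "eventually (\<lambda>x. x \<in> A \<and> dist (f x) y0 < e / 2 \<and> (\<forall>k\<in>{..<n}. \<bar>\<phi> k x\<bar> < M k)) (nhds x0)"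
    using eventually_nhds_in_open[OF AC(1,3)] by eventually_elim (simp add: f0)
  then obtain S where S: "open S" "x0 \<in> S"
    "\<And>x. x \<in> S \<Longrightarrow> x \<in> A \<and> dist (f x) y0 < e / 2 \<and> (\<forall>k\<in>{..<n}. \<bar>\<phi> k x\<bar> < M k)"
    unfolding eventually_nhds by blast
  obtain J where J: "open_interval J" "x0 \<in> J" "J \<subseteq> S" by (rule open_intervalE[OF S(1,2)])
  have oJ: "open J" using J(1) by (simp add: open_interval_def)
  have JA: "J \<subseteq> A" using J(3) S(3) by blast
  have JI: "J \<subseteq> I" using JA box y0 U(2) by blast
  have sfJ: "smooth_on J f" and s\<phi>J: "smooth_on J (\<phi> k)" for k
    by (rule smooth_on_subset[OF sf JA], rule smooth_on_subset[OF s\<phi> JA])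
  have s\<zeta>J: "smooth_on J \<zeta>" by (rule smooth_on_subset[OF s(1) JA])
  have pull: "solves n a J (\<lambda>x. f x + \<epsilon> * \<phi> k x)"
    if k: "k < n" and \<epsilon>: "\<And>x. x \<in> J \<Longrightarrow> \<bar>\<epsilon> * \<phi> k x\<bar> < e / 2" for \<epsilon> k
  proof -
    define y where "y x = f x + \<epsilon> * \<phi> k x" for x
    have y: "smooth_on J y" unfolding y_def by (intro smooth_on_add smooth_on_mult smooth_on_const sfJ s\<phi>J)
    have yb: "y x \<in> ball y0 e" if x: "x \<in> J" for x
    proof -
      have "dist (f x) y0 < e / 2" using S(3) J(3) x by blast
      then show ?thesis using \<epsilon>[OF x] unfolding y_def mem_ball dist_real_def by linarith
    qed
    have ZJ: "Z (x, y x) = \<zeta> x" if "x \<in> J" for x using Z yb that JA by blast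
    obtain K w where w: "transforms_to U \<Phi> J y K w"
    proof (rule push_forward[OF \<Phi> J(1) y])
      show "(x, y x) \<in> U" if "x \<in> J" for x using box yb that JA by blast
      show "deriv (\<lambda>x. fst (\<Phi> (x, y x))) x \<noteq> 0" if x: "x \<in> J" for x
      proof -
        have "deriv (\<lambda>x. fst (\<Phi> (x, y x))) x = deriv \<zeta> x"
          using funpow_deriv_cong_open[OF oJ ZJ x, where k = 1] by (simp add: fst_\<Phi>)
        then show ?thesis using nondeg(2) x JA by auto
      qed
    qed auto
    define q where "q = [:w1:] + monom \<epsilon> k"
    have q: "degree q < n" unfolding q_def
      by (rule degree_add_less) (use k in \<open>auto intro: le_less_trans[OF degree_monom_le]\<close>)
    have wq: "w z = poly q z" if "z \<in> K" for z
    proof -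
      have "z \<in> (\<lambda>x. Z (x, y x)) ` J" using transforms_to_image[OF w] that by (simp add: fst_\<Phi>)
      then obtain x where x: "x \<in> J" "z = Z (x, y x)" by blast
      then have xA: "x \<in> A" using JA by blast
      have "w z = W (x, y x)" using transforms_to_Z_W(3)[OF w x(1)] x(2) by simp
      also have "\<dots> = \<gamma> x * y x + h x" by (rule W[OF xA yb[OF x(1)]])
      also have "\<dots> = w1 + \<epsilon> * \<zeta> x ^ k"
        using nondeg(1)[OF xA] by (simp add: y_def f_def \<phi>_def field_simps)
      also have "\<dots> = poly q z" using x ZJ by (simp add: q_def poly_monom)
      finally show ?thesis .
    qed
    have oK: "open K" using w by (simp add: transforms_to_def open_interval_def)
    have "(deriv ^^ n) w z = 0" if "z \<in> K" for z
      using funpow_deriv_cong_open[OF oK wq that, where k = n] q by (simp add: funpow_deriv_poly_eq_0)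
    then have "solves n a J y" using red[OF w] by blast
    then show ?thesis unfolding y_def .
  qed
  have sol: "solves n a J (\<phi> k)" if k: "k < n" for k
  proof -
    define \<epsilon> where "\<epsilon> = e / (2 * M k)"
    \<comment> \<open>The bound \<open>M k\<close> holds for \<open>\<phi> k\<close> on all of \<open>J\<close>, so this factor keeps the graph in the box.\<close>
    have M: "M k > 0" by (simp add: M_def)
    have \<epsilon>0: "\<epsilon> > 0" using e(1) M by (simp add: \<epsilon>_def)
    have "\<bar>\<epsilon> * \<phi> k x\<bar> < e / 2" if "x \<in> J" for x
    proof -
      have "\<bar>\<phi> k x\<bar> < M k" using S(3) J(3) that k by blast
      then have "\<epsilon> * \<bar>\<phi> k x\<bar> < \<epsilon> * M k" using \<epsilon>0 by simp
      also have "\<dots> = e / 2" using M by (simp add: \<epsilon>_def)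
      finally show ?thesis using \<epsilon>0 by (simp add: abs_mult)
    qed
    then have 1: "solves n a J (\<lambda>x. f x + \<epsilon> * \<phi> k x)" by (rule pull[OF k])
    have 2: "solves n a J (\<lambda>x. f x + 0 * \<phi> k x)" by (rule pull[OF k]) (use e(1) in simp)
    have sm: "smooth_on J (\<lambda>x. f x + c * \<phi> k x)" for c
      by (intro smooth_on_add smooth_on_mult smooth_on_const sfJ s\<phi>J)
    have "solves n a J (\<lambda>x. (1 / \<epsilon>) * ((f x + \<epsilon> * \<phi> k x) - (f x + 0 * \<phi> k x)))"
      by (intro solves_cmult[OF oJ] solves_diff[OF oJ] smooth_on_diff sm 1 2)
    then show ?thesis
      by (rule solves_cong[OF oJ, rotated]) (use \<epsilon>0 in simp)
  qed
  have "iterative_on J n a"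
  proof (rule iterative_on_of_fundamental_system[OF ode J(1) JI s\<zeta>J])
    show "smooth_on J (\<lambda>x. inverse (\<gamma> x))"
      by (intro smooth_on_inverse smooth_on_subset[OF s(2) JA]) (use nondeg JA in auto)
    show "solves n a J (\<lambda>x. \<zeta> x ^ k * inverse (\<gamma> x))" if "k < n" for k
      using sol[OF that] unfolding \<phi>_def .
  qed (use nondeg JA in auto)
  then show ?thesis unfolding iterative_near_def using J(1,2) JI by blast
qed

end

text \<open>A first order operator \<open>a\<^sub>0 d/dx + a\<^sub>1\<close> already is of the form \<open>\<Psi>\<close>.\<close>

lemma iterative_near_of_order_1:
  assumes ode: "linear_ode I 1 a" and x0: "x0 \<in> I"
  shows "iterative_near I 1 a x0"
proof -
  have "iterative_on I 1 a" unfolding iterative_on_def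
  proof (intro exI conjI allI impI ballI)
    show "smooth_on I (a 0)" "smooth_on I (a 1)" "smooth_on I (\<lambda>x. 1 :: real)"
      using ode by (simp_all add: linear_ode_def smooth_on_const)
    show "a 0 x \<noteq> 0" if "x \<in> I" for x using ode that by (simp add: linear_ode_def)
    show "(iter_op (a 0) (a 1) ^^ 1) y x = 1 * ode_lhs 1 a y x" for y x
      by (simp add: iter_op_def ode_lhs_def)
  qed simp
  then show ?thesis unfolding iterative_near_def using ode x0 by (auto simp: linear_ode_def)
qed

lemma iterative_near_of_reducible_near:
  assumes n: "n \<ge> 1" and ode: "linear_ode I n a" and x0: "x0 \<in> I"
    and red: "reducible_near I n a (x0, y0)"
  shows "iterative_near I n a x0"
proof -
  from red obtain U \<Phi> where pU: "(x0, y0) \<in> U" "U \<subseteq> I \<times> UNIV" and \<Phi>: "point_transformation U \<Phi>"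
    and r: "\<forall>J y K w. transforms_to U \<Phi> J y K w \<longrightarrow> (solves n a J y \<longleftrightarrow> (\<forall>z\<in>K. (deriv ^^ n) w z = 0))"
    unfolding reducible_near_def by (elim exE conjE)
  from \<Phi> obtain \<Theta> where \<Theta>: "point_transformation (\<Phi> ` U) \<Theta>" "\<And>p. p \<in> U \<Longrightarrow> \<Theta> (\<Phi> p) = p"
    by (rule point_transformation_inverse) (rule that)
  interpret reduction I n a U \<Phi> \<Theta>
  proof
    show "open U" "smooth_on U \<Phi>" "open (\<Phi> ` U)" "smooth_on (\<Phi> ` U) \<Theta>"
      using \<Phi> \<Theta>(1) by (auto simp: point_transformation_def)
    show "\<Theta> (\<Phi> p) = p" if "p \<in> U" for p by (rule \<Theta>(2)[OF that])
    show "solves n a J y \<longleftrightarrow> (\<forall>z\<in>K. (deriv ^^ n) w z = 0)" if "transforms_to U \<Phi> J y K w" for J y K w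
      using r that by blast
  qed (fact ode pU(2))+
  consider "n = 1" | "n = 2" | "n \<ge> 3" using n by linarith
  then show ?thesis
  proof cases
    case 1
    then show ?thesis using iterative_near_of_order_1 ode x0 by simp
  next
    case 2
    then show ?thesis using iterative_near_of_order_2 pU(1) by blast
  next
    case 3
    then show ?thesis using iterative_near_of_order_ge_3 pU(1) by blast
  qed
qed

theorem theorem1:
  fixes I :: "real set" and n :: nat and a :: "nat \<Rightarrow> real \<Rightarrow> real" and x0 y0 :: real
  assumes "n \<ge> 1" and "linear_ode I n a" and "x0 \<in> I"
  shows "iterative_near I n a x0 \<longleftrightarrow> reducible_near I n a (x0, y0)"
  using reducible_near_of_iterative_near[OF assms(1)] iterative_near_of_reducible_near[OF assms] by blast

end
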